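(* Fix a real $\alpha$ with $0\le\alpha\le1/2$. Consider $n\to\infty$ along even integers $n=2m$ for which $l:=\alpha n$ is an integer, and let $X$ be distributed according to $p(\cdot\mid 2m,m,2l,l)$. Then \[ \lim_{n\to\infty}\mathbb E\Bigl[\frac Xn\Bigr]=\alpha, \] and this value equals $\mu:=(1-\sqrt{1-4(\alpha\gamma+\alpha\delta+\beta\gamma)})/2$ for $\beta=\delta=\frac12-\alpha$, $\gamma=\alpha$.
   Context: For non-negative integers $n,m,k,l$ with $m,k\le n$ and $m+k-n\le l\le\min(m,k)$, let $M:=m-l$, $N:=n-m-k+l$. Let $\mathbb{C}^2$ have orthonormal basis $|0\rangle,|1\rangle$ and give $(\mathbb{C}^2)^{\otimes n}$ the induced Hermitian inner product. Define $|\Xi_{n,m|k,l}\rangle:=|1\rangle^{\otimes l}\otimes|0\rangle^{\otimes(k-l)}\otimes\binom{M+N}{M}^{-1/2}\sum_{I}|I\rangle$, the sum over all $I\in\{0,1\}^{n-k}$ with exactly $M$ ones (where $|i_1\cdots i_r\rangle=|i_1\rangle\otimes\cdots\otimes|i_r\rangle$). $\mathfrak S_n$ acts on $(\mathbb{C}^2)^{\otimes n}$ by permuting tensor factors. For $0\le x\le\lfloor n/2\rfloor$, $\mathsf P_{(n-x,x)}$ is the orthogonal projection onto the isotypic component of the irreducible $\mathfrak S_n$-representation labelled by the partition $(n-x,x)$, and $p(x\mid n,m,k,l):=\langle\Xi_{n,m|k,l}|\mathsf P_{(n-x,x)}|\Xi_{n,m|k,l}\rangle$, a probability mass function on $\{0,\dots,\lfloor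 n/2\rfloor\}$. *)

theory Defs
  imports Complex_Main "HOL-Combinatorics.Permutations"
begin

definition cscale :: "complex \<Rightarrow> ('a \<Rightarrow> complex) \<Rightarrow> ('a \<Rightarrow> complex)" where
  "cscale c f = (\<lambda>b. c * f b)"

definition cadd :: "('a \<Rightarrow> complex) \<Rightarrow> ('a \<Rightarrow> complex) \<Rightarrow> ('a \<Rightarrow> complex)" where
  "cadd f g = (\<lambda>b. f b + g b)"

definition csub :: "('a \<Rightarrow> complex) \<Rightarrow> ('a \<Rightarrow> complex) \<Rightarrow> ('a \<Rightarrow> complex)" where
  "csub f g = (\<lambda>b. f b - g b)"

definition lin_subspace :: "('a \<Rightarrow> complex) set \<Rightarrow> bool" where
  "lin_subspace U \<longleftrightarrow> (\<lambda>_. 0) \<in> U \<and> (\<forall>f\<in>U. \<forall>g\<in>U. cadd f g \<in> U) \<and> (\<forall>c. \<forall>f\<in>U. cscale c f \<in> U)"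

definition cspan :: "('a \<Rightarrow> complex) set \<Rightarrow> ('a \<Rightarrow> complex) set" where
  "cspan A = \<Inter>{U. lin_subspace U \<and> A \<subseteq> U}"

text \<open>Basis vectors |i_1 ... i_n> are indexed by boolean lists of length n;
  False stands for |0> and True for |1>.\<close>

definition strings :: "nat \<Rightarrow> bool list set" where
  "strings n = {s. length s = n}"

definition tensor_space :: "nat \<Rightarrow> (bool list \<Rightarrow> complex) set" where
  "tensor_space n = {f. \<forall>s. length s \<noteq> n \<longrightarrow> f s = 0}"

definition tinner :: "nat \<Rightarrow> (bool list \<Rightarrow> complex) \<Rightarrow> (bool list \<Rightarrow> complex) \<Rightarrow> complex" where
  "tinner n f g = (\<Sum>s\<in>strings n. cnj (f s) * g s)"

text \<open>Action of a permutation of the tensor positions {0..<n}: the left action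
  (sigma . f)(s) = f(s o sigma).\<close>
definition act_V :: "nat \<Rightarrow> (nat \<Rightarrow> nat) \<Rightarrow> (bool list \<Rightarrow> complex) \<Rightarrow> (bool list \<Rightarrow> complex)" where
  "act_V n \<sigma> f = (\<lambda>s. if length s = n then f (map (\<lambda>i. s ! \<sigma> i) [0..<n]) else 0)"

text \<open>Tabloids of shape (n-x,x) are identified with their second row, an x-subset of {0..<n};
  the permutation module M^{(n-x,x)} consists of functions on x-subsets.\<close>

definition tabloid_space :: "nat \<Rightarrow> nat \<Rightarrow> (nat set \<Rightarrow> complex) set" where
  "tabloid_space n x = {g. \<forall>T. \<not> (T \<subseteq> {0..<n} \<and> card T = x) \<longrightarrow> g T = 0}"

definition act_M :: "(nat \<Rightarrow> nat) \<Rightarrow> (nat set \<Rightarrow> complex) \<Rightarrow> (nat set \<Rightarrow> complex)" where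
  "act_M \<sigma> g = (\<lambda>T. g (\<sigma> -` T))"

text \<open>A tableau of shape (n-x,x): column j < x has top entry a j and bottom entry b j;
  the remaining entries of the first row form singleton columns.  The polytabloid
  e_t = sum over the column group with signs.\<close>
definition valid_tableau :: "nat \<Rightarrow> nat \<Rightarrow> (nat \<Rightarrow> nat) \<Rightarrow> (nat \<Rightarrow> nat) \<Rightarrow> bool" where
  "valid_tableau n x a b \<longleftrightarrow>
     inj_on (\<lambda>j. if j < x then a j else b (j - x)) {0..<2*x} \<and>
     (\<forall>j<x. a j < n \<and> b j < n)"

definition polytabloid :: "nat \<Rightarrow> (nat \<Rightarrow> nat) \<Rightarrow> (nat \<Rightarrow> nat) \<Rightarrow> (nat set \<Rightarrow> complex)" where
  "polytabloid x a b = (\<lambda>T. \<Sum>c\<in>Pow {0..<x}.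
      if T = (\<lambda>j. if j \<in> c then a j else b j) ` {0..<x} then (-1) ^ card c else 0)"

definition specht :: "nat \<Rightarrow> nat \<Rightarrow> (nat set \<Rightarrow> complex) set" where
  "specht n x = cspan {polytabloid x a b | a b. valid_tableau n x a b}"

definition equivariant_iso ::
  "nat \<Rightarrow> nat \<Rightarrow> ((nat set \<Rightarrow> complex) \<Rightarrow> (bool list \<Rightarrow> complex)) \<Rightarrow> (bool list \<Rightarrow> complex) set \<Rightarrow> bool" where
  "equivariant_iso n x \<phi> U \<longleftrightarrow>
     bij_betw \<phi> (specht n x) U \<and>
     (\<forall>g\<in>specht n x. \<forall>h\<in>specht n x. \<phi> (cadd g h) = cadd (\<phi> g) (\<phi> h)) \<and>
     (\<forall>c. \<forall>g\<in>specht n x. \<phi> (cscale c g) = cscale c (\<phi> g)) \<and>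
     (\<forall>\<sigma>. \<sigma> permutes {0..<n} \<longrightarrow> (\<forall>g\<in>specht n x. \<phi> (act_M \<sigma> g) = act_V n \<sigma> (\<phi> g)))"

definition isotypic :: "nat \<Rightarrow> nat \<Rightarrow> (bool list \<Rightarrow> complex) set" where
  "isotypic n x = cspan (\<Union>{U. U \<subseteq> tensor_space n \<and> lin_subspace U \<and>
       (\<forall>\<sigma> f. \<sigma> permutes {0..<n} \<longrightarrow> f \<in> U \<longrightarrow> act_V n \<sigma> f \<in> U) \<and>
       (\<exists>\<phi>. equivariant_iso n x \<phi> U)})"

definition oproj :: "nat \<Rightarrow> (bool list \<Rightarrow> complex) set \<Rightarrow> (bool list \<Rightarrow> complex) \<Rightarrow> (bool list \<Rightarrow> complex)" where
  "oproj n W v = (THE w. w \<in> W \<and> (\<forall>u\<in>W. tinner n u (csub v w) = 0))"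

definition Xi :: "nat \<Rightarrow> nat \<Rightarrow> nat \<Rightarrow> nat \<Rightarrow> (bool list \<Rightarrow> complex)" where
  "Xi n m k l = (\<lambda>s.
     if length s = n \<and> take l s = replicate l True
        \<and> take (k - l) (drop l s) = replicate (k - l) False
        \<and> length (filter id (drop k s)) = m - l
     then complex_of_real (1 / sqrt (real ((m - l + (n + l - (m + k))) choose (m - l))))
     else 0)"

definition pdist :: "nat \<Rightarrow> nat \<Rightarrow> nat \<Rightarrow> nat \<Rightarrow> nat \<Rightarrow> complex" where
  "pdist x n m k l = tinner n (Xi n m k l) (oproj n (isotypic n x) (Xi n m k l))"

end

(* The sum of all transpositions acts on the isotypic component of (n-x,x) by a scalar that is
   essentially n^2 - 2x(n-x), hence a strictly monotone function of x, and the state is almost an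
   eigenvector of this sum: with n = 2m, applying it returns c = 2m^2 + 2(m-l)^2 times the state
   plus a remainder of squared norm at most 2n^3, which is negligible against n^4.  Therefore X/n
   concentrates where the eigenvalue is close to c, that is at l/n.

   Two facts about Specht modules are needed.  Their elements are harmonic, i.e. annihilated by the
   map to (x-1)-subsets, which yields the eigenvalue.  Conversely a harmonic function orthogonal
   to all polytabloids vanishes, which yields both the injectivity of the embedding of the Specht
   modules into the tensor space and the completeness of the isotypic decomposition on the relevant
   weight space. *)

theory Submission
  imports Defs
begin

section \<open>Orthogonal projection onto finitely supported subspaces\<close>

text \<open>The definition of \<open>isotypic\<close> ranges over all copies of a Specht module.
  This creates two opposite needs: every copy, given by an arbitrary isomorphism, has to lie in one
  eigenspace, whereas completeness rests on a single explicit copy for each x, the embedding into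
  weight m by subset sums. Distinctness of the eigenvalues for 2x \<le> n takes the place of Schur's
  lemma and of dimension counts.

  The constant c counts the swaps that keep a basis vector in the support of the state: 2m^2 swaps
  of equal bits and 2(m-l)^2 swaps of different bits in the free block. It equals the eigenvalue at
  l plus 2l. The bound 2n^3 is a maximum times a total: a coefficient of the remainder arises from
  at most 2n swaps, and all swap counts together amount to n^2 times the size of the support.

  For l near m the eigenvalue is almost stationary at l, so its deviation controls (x-l)^2 rather
  than x-l. Hence it is the fourth moment of X-l that is bounded, by O(n^3) uniformly in l, and this
  yields E|X-l| = o(n).\<close>

definition inner_on :: "'a set \<Rightarrow> ('a \<Rightarrow> complex) \<Rightarrow> ('a \<Rightarrow> complex) \<Rightarrow> complex" where
  "inner_on S f g = (\<Sum>s\<in>S. cnj (f s) * g s)"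

lemma inner_on_cadd_left: "inner_on S (cadd f g) h = inner_on S f h + inner_on S g h"
  by (simp add: inner_on_def cadd_def algebra_simps sum.distrib)

lemma inner_on_cadd_right: "inner_on S h (cadd f g) = inner_on S h f + inner_on S h g"
  by (simp add: inner_on_def cadd_def algebra_simps sum.distrib)

lemma inner_on_csub_left: "inner_on S (csub f g) h = inner_on S f h - inner_on S g h"
  by (simp add: inner_on_def csub_def algebra_simps sum_subtractf)

lemma inner_on_csub_right: "inner_on S h (csub f g) = inner_on S h f - inner_on S h g"
  by (simp add: inner_on_def csub_def algebra_simps sum_subtractf)

lemma inner_on_cscale_left: "inner_on S (cscale c f) h = cnj c * inner_on S f h"
  by (simp add: inner_on_def cscale_def sum_distrib_left mult.assoc)

lemma inner_on_cscale_right: "inner_on S h (cscale c f) = c * inner_on S h f"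
  by (simp add: inner_on_def cscale_def sum_distrib_left algebra_simps)

lemmas inner_on_linear = inner_on_cadd_left inner_on_cadd_right inner_on_csub_left
  inner_on_csub_right inner_on_cscale_left inner_on_cscale_right

lemma cnj_inner_on: "cnj (inner_on S f g) = inner_on S g f"
  by (simp add: inner_on_def mult.commute)

lemma inner_on_self: "inner_on S f f = of_real (\<Sum>s\<in>S. (cmod (f s))\<^sup>2)"
  unfolding inner_on_def of_real_sum
  by (rule sum.cong[OF refl]) (metis complex_norm_square mult.commute)

lemma inner_on_self_eq_0:
  assumes "finite S" "inner_on S f f = 0" "s \<in> S"
  shows "f s = 0"
proof -
  have "(\<Sum>s\<in>S. (cmod (f s))\<^sup>2) = 0"
    using assms(2) unfolding inner_on_self by (simp only: of_real_eq_0_iff)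
  then show ?thesis
    using assms by (simp add: sum_nonneg_eq_0_iff)
qed

lemma lin_subspace_cadd: "lin_subspace U \<Longrightarrow> f \<in> U \<Longrightarrow> g \<in> U \<Longrightarrow> cadd f g \<in> U"
  and lin_subspace_cscale: "lin_subspace U \<Longrightarrow> f \<in> U \<Longrightarrow> cscale c f \<in> U"
  and lin_subspace_zero: "lin_subspace U \<Longrightarrow> (\<lambda>_. 0) \<in> U"
  by (auto simp: lin_subspace_def)

lemma csub_eq_cadd: "csub f g = cadd f (cscale (-1) g)"
  by (simp add: csub_def cadd_def cscale_def)

lemma lin_subspace_csub: "lin_subspace U \<Longrightarrow> f \<in> U \<Longrightarrow> g \<in> U \<Longrightarrow> csub f g \<in> U"
  by (simp add: csub_eq_cadd lin_subspace_cadd lin_subspace_cscale)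

lemma lin_subspace_sum:
  assumes "lin_subspace U" "finite I" "\<And>i. i \<in> I \<Longrightarrow> f i \<in> U"
  shows "(\<lambda>b. \<Sum>i\<in>I. f i b) \<in> U"
  using assms(2,3)
proof (induction I)
  case empty
  then show ?case using lin_subspace_zero[OF assms(1)] by simp
next
  case (insert i I)
  then have "cadd (f i) (\<lambda>b. \<Sum>i\<in>I. f i b) \<in> U"
    by (simp add: lin_subspace_cadd[OF assms(1)])
  with insert show ?case by (simp add: cadd_def)
qed

lemma lin_subspace_cspan: "lin_subspace (cspan A)"
  by (auto simp: lin_subspace_def cspan_def)

lemma cspan_superset: "A \<subseteq> cspan A"
  by (auto simp: cspan_def)

lemma cspan_minimal: "lin_subspace U \<Longrightarrow> A \<subseteq> U \<Longrightarrow> cspan A \<subseteq> U"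
  by (auto simp: cspan_def)

text \<open>Induction on the support. The vectors of \<open>W\<close> vanishing at the new point
  form a subspace \<open>W0\<close> of codimension at most one. If it is proper, a vector outside it
  minus its projection onto \<open>W0\<close> spans the orthogonal complement of \<open>W0\<close>
  in \<open>W\<close>, and the projection onto \<open>W\<close> is the one onto \<open>W0\<close>
  plus one Gram-Schmidt term.\<close>

lemma orthogonal_projection_exists:
  assumes "finite S" "lin_subspace W" "\<And>f s. f \<in> W \<Longrightarrow> s \<notin> S \<Longrightarrow> f s = 0"
  shows "\<exists>w\<in>W. \<forall>u\<in>W. inner_on S u (csub v w) = 0"
  using assms
proof (induction S arbitrary: W v rule: finite_induct)
  case empty
  then show ?case using lin_subspace_zero[of W] by (auto simp: inner_on_def)
next
  case (insert s S)
  define W0 where "W0 = {f \<in> W. f s = 0}"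
  have W0: "lin_subspace W0"
    using insert.prems(1) unfolding W0_def lin_subspace_def by (auto simp: cadd_def cscale_def)
  have supp0: "f t = 0" if "f \<in> W0" "t \<notin> S" for f t
    using that insert.prems(2)[of f t] unfolding W0_def by (cases "t = s") auto
  have ip0: "inner_on (insert s S) u f = inner_on S u f" if "u \<in> W0" for u f
    using that insert.hyps by (simp add: inner_on_def W0_def)
  have proj0: "\<exists>w\<in>W0. \<forall>u\<in>W0. inner_on (insert s S) u (csub v w) = 0" for v
    using insert.IH[OF W0, of v] supp0 ip0 by auto
  show ?case
  proof (cases "W \<subseteq> W0")
    case True
    then have "W = W0" by (auto simp: W0_def)
    then show ?thesis using proj0 by simp
  next
    case False
    then obtain f0 where f0: "f0 \<in> W" "f0 s \<noteq> 0" by (auto simp: W0_def)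
    obtain p where p: "p \<in> W0" "\<forall>u\<in>W0. inner_on (insert s S) u (csub f0 p) = 0"
      using proj0 by blast
    obtain q where q: "q \<in> W0" "\<forall>u\<in>W0. inner_on (insert s S) u (csub v q) = 0"
      using proj0 by blast
    define f1 where "f1 = csub f0 p"
    have f1: "f1 \<in> W" "f1 s \<noteq> 0"
      using f0 p insert.prems(1)
      by (auto simp: f1_def W0_def csub_def intro: lin_subspace_csub[unfolded csub_def])
    have orth: "inner_on (insert s S) u f1 = 0" if "u \<in> W0" for u
      using p that by (simp add: f1_def)
    have orth': "inner_on (insert s S) f1 u = 0" if "u \<in> W0" for u
      using orth[OF that] cnj_inner_on[of "insert s S" u f1] by simp
    have N: "inner_on (insert s S) f1 f1 \<noteq> 0"
      using inner_on_self_eq_0[of "insert s S" f1 s] f1 insert.hyps by auto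
    define c where "c = inner_on (insert s S) f1 v / inner_on (insert s S) f1 f1"
    define w where "w = cadd q (cscale c f1)"
    have "w \<in> W"
      using q f1 insert.prems(1) by (auto simp: w_def W0_def intro!: lin_subspace_cadd lin_subspace_cscale)
    moreover have "inner_on (insert s S) u (csub v w) = 0" if "u \<in> W" for u
    proof -
      define d where "d = u s / f1 s"
      define u0 where "u0 = csub u (cscale d f1)"
      have "u0 \<in> W"
        unfolding u0_def using that f1 insert.prems(1)
        by (intro lin_subspace_csub lin_subspace_cscale)
      then have u0: "u0 \<in> W0"
        using f1 by (simp add: W0_def u0_def d_def csub_def cscale_def)
      have u: "u = cadd u0 (cscale d f1)"
        by (auto simp: u0_def cadd_def csub_def cscale_def)
      have "inner_on (insert s S) u0 (csub v q) = 0" using q u0 by blast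
      then show ?thesis
        unfolding u w_def using orth[OF u0] orth'[OF q(1)] N
        by (simp add: inner_on_linear c_def)
    qed
    ultimately show ?thesis by blast
  qed
qed

section \<open>Mixed differences\<close>

text \<open>The pairing of \<open>h\<close> with a polytabloid, one column at a time; \<open>R\<close> collects the
  elements that are held fixed.\<close>

fun mixed_diff ::
  "(nat \<Rightarrow> nat) \<Rightarrow> (nat \<Rightarrow> nat) \<Rightarrow> nat \<Rightarrow> nat set \<Rightarrow> (nat set \<Rightarrow> complex) \<Rightarrow> complex" where
  "mixed_diff a b 0 R h = h R"
| "mixed_diff a b (Suc k) R h =
     mixed_diff a b k (insert (b k) R) h - mixed_diff a b k (insert (a k) R) h"

definition entries :: "nat \<Rightarrow> (nat \<Rightarrow> nat) \<Rightarrow> (nat \<Rightarrow> nat) \<Rightarrow> nat set" where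
  "entries k a b = a ` {0..<k} \<union> b ` {0..<k}"

lemma entries_0 [simp]: "entries 0 a b = {}"
  by (simp add: entries_def)

lemma entries_Suc: "entries (Suc k) a b = insert (a k) (insert (b k) (entries k a b))"
  by (auto simp: entries_def atLeast0_lessThan_Suc)

lemma finite_entries [simp]: "finite (entries k a b)"
  by (simp add: entries_def)

lemma valid_tableau_0 [simp]: "valid_tableau n 0 a b"
  by (simp add: valid_tableau_def)

lemma valid_tableau_iff:
  "valid_tableau n x a b \<longleftrightarrow>
     inj_on a {0..<x} \<and> inj_on b {0..<x} \<and> a ` {0..<x} \<inter> b ` {0..<x} = {} \<and>
     entries x a b \<subseteq> {0..<n}" (is "?L \<longleftrightarrow> ?R")
proof
  assume L: ?L
  then have inj: "inj_on (\<lambda>j. if j < x then a j else b (j - x)) {0..<2*x}"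
    and bd: "\<forall>j<x. a j < n \<and> b j < n" by (auto simp: valid_tableau_def)
  have "inj_on a {0..<x}"
  proof (rule inj_onI)
    fix i j assume "i \<in> {0..<x}" "j \<in> {0..<x}" "a i = a j"
    then show "i = j" using inj_onD[OF inj, of i j] by simp
  qed
  moreover have "inj_on b {0..<x}"
  proof (rule inj_onI)
    fix i j assume "i \<in> {0..<x}" "j \<in> {0..<x}" "b i = b j"
    then show "i = j" using inj_onD[OF inj, of "i + x" "j + x"] by auto
  qed
  moreover have "a i \<noteq> b j" if "i < x" "j < x" for i j
    using inj_onD[OF inj, of i "j + x"] that by auto
  ultimately show ?R using bd by (fastforce simp: entries_def)
next
  assume R: ?R
  then have ne: "a i \<noteq> b j" if "i < x" "j < x" for i j
    using that by fastforce
  have "inj_on (\<lambda>j. if j < x then a j else b (j - x)) {0..<2*x}"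
  proof (rule inj_onI)
    fix i j assume ij: "i \<in> {0..<2*x}" "j \<in> {0..<2*x}"
      "(if i < x then a i else b (i - x)) = (if j < x then a j else b (j - x))"
    show "i = j"
    proof (cases "i < x"; cases "j < x")
      assume "i < x" "j < x" then show ?thesis using ij R inj_onD[of a "{0..<x}" i j] by simp
    next
      assume "\<not> i < x" "\<not> j < x"
      moreover then have "i - x \<in> {0..<x}" "j - x \<in> {0..<x}" "b (i - x) = b (j - x)"
        using ij by auto
      then have "i - x = j - x" using R by (meson inj_onD)
      ultimately show ?thesis by simp
    next
      assume "i < x" "\<not> j < x" then show ?thesis using ij ne[of i "j - x"] by auto
    next
      assume A: "\<not> i < x" "j < x"
      then have "i - x < x" using ij(1) by auto
      then show ?thesis using A ij(3) ne[of j "i - x"] by simp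
    qed
  qed
  then show ?L using R by (auto simp: valid_tableau_def entries_def image_subset_iff)
qed

lemma valid_tableau_Suc_iff:
  "valid_tableau n (Suc k) a b \<longleftrightarrow>
     valid_tableau n k a b \<and> a k < n \<and> b k < n \<and> a k \<noteq> b k \<and>
     a k \<notin> entries k a b \<and> b k \<notin> entries k a b"
  unfolding valid_tableau_iff entries_Suc atLeast0_lessThan_Suc
  by (auto simp: entries_def)

lemma mixed_diff_cong:
  assumes "\<And>j. j < k \<Longrightarrow> a j = a' j" "\<And>j. j < k \<Longrightarrow> b j = b' j"
  shows "mixed_diff a b k R h = mixed_diff a' b' k R h"
  using assms by (induction k arbitrary: R) auto

lemma entries_cong:
  assumes "\<And>j. j < k \<Longrightarrow> a j = a' j" "\<And>j. j < k \<Longrightarrow> b j = b' j"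
  shows "entries k a b = entries k a' b'"
  using assms unfolding entries_def by (metis (no_types, lifting) atLeastLessThan_iff image_cong)

lemma valid_tableau_cong:
  assumes "\<And>j. j < k \<Longrightarrow> a j = a' j" "\<And>j. j < k \<Longrightarrow> b j = b' j"
  shows "valid_tableau n k a b = valid_tableau n k a' b'"
proof -
  have "inj_on a {0..<k} = inj_on a' {0..<k}" "inj_on b {0..<k} = inj_on b' {0..<k}"
    "a ` {0..<k} = a' ` {0..<k}" "b ` {0..<k} = b' ` {0..<k}"
    using assms by (auto intro!: inj_on_cong image_cong)
  then show ?thesis
    unfolding valid_tableau_iff entries_def by (simp only:)
qed

lemma mixed_diff_eq_sum:
  "mixed_diff a b k R h =
     (\<Sum>c\<in>Pow {0..<k}. (-1) ^ card c * h (R \<union> (\<lambda>j. if j \<in> c then a j else b j) ` {0..<k}))"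
proof (induction k arbitrary: R)
  case 0
  then show ?case by simp
next
  case (Suc k)
  let ?F = "\<lambda>k c. (\<lambda>j. if j \<in> c then a j else b j) ` {0..<k}"
  have Pow: "Pow {0..<Suc k} = Pow {0..<k} \<union> insert k ` Pow {0..<k}"
    by (simp add: atLeast0_lessThan_Suc Pow_insert)
  have disj: "Pow {0..<k} \<inter> insert k ` Pow {0..<k} = {}" by auto
  have inj: "inj_on (insert k) (Pow {0..<k})"
    by (rule inj_onI) (metis Pow_iff atLeastLessThan_iff insert_ident less_irrefl subsetD)
  have 1: "R \<union> ?F (Suc k) c = insert (b k) R \<union> ?F k c" if "c \<in> Pow {0..<k}" for c
    using that by (auto simp: atLeast0_lessThan_Suc)
  have 2: "R \<union> ?F (Suc k) (insert k c) = insert (a k) R \<union> ?F k c" if "c \<in> Pow {0..<k}" for c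
    using that by (auto simp: atLeast0_lessThan_Suc)
  have 3: "card (insert k c) = Suc (card c)" if "c \<in> Pow {0..<k}" for c
    using that by (metis Pow_iff atLeastLessThan_iff card_insert_disjoint finite_atLeastLessThan
        finite_subset less_irrefl subsetD)
  have "(\<Sum>c\<in>Pow {0..<Suc k}. (-1) ^ card c * h (R \<union> ?F (Suc k) c)) =
     (\<Sum>c\<in>Pow {0..<k}. (-1) ^ card c * h (R \<union> ?F (Suc k) c)) +
     (\<Sum>c\<in>Pow {0..<k}. (-1) ^ card (insert k c) * h (R \<union> ?F (Suc k) (insert k c)))"
    unfolding Pow by (simp only: sum.union_disjoint[OF _ _ disj] finite_Pow_iff finite_imageI
        finite_atLeastLessThan sum.reindex[OF inj] o_def)
  also have "(\<Sum>c\<in>Pow {0..<k}. (-1) ^ card c * h (R \<union> ?F (Suc k) c)) =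
      (\<Sum>c\<in>Pow {0..<k}. (-1) ^ card c * h (insert (b k) R \<union> ?F k c))"
    by (rule sum.cong[OF refl]) (simp only: 1)
  also have "(\<Sum>c\<in>Pow {0..<k}. (-1) ^ card (insert k c) * h (R \<union> ?F (Suc k) (insert k c))) =
      - (\<Sum>c\<in>Pow {0..<k}. (-1) ^ card c * h (insert (a k) R \<union> ?F k c))"
    unfolding sum_negf[symmetric] by (rule sum.cong[OF refl]) (simp only: 2 3, simp)
  finally show ?case using Suc.IH by simp
qed

lemma sum_polytabloid_eq_mixed_diff:
  assumes "valid_tableau n x a b"
  shows "(\<Sum>T\<in>Pow {0..<n}. polytabloid x a b T * h T) = mixed_diff a b x {} h"
proof -
  let ?F = "\<lambda>c. (\<lambda>j. if j \<in> c then a j else b j) ` {0..<x}"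
  have sub: "?F c \<subseteq> {0..<n}" for c
    using assms by (auto simp: valid_tableau_def)
  have "(\<Sum>T\<in>Pow {0..<n}. polytabloid x a b T * h T) =
     (\<Sum>c\<in>Pow {0..<x}. \<Sum>T\<in>Pow {0..<n}. if T = ?F c then (-1) ^ card c * h T else 0)"
    unfolding polytabloid_def sum_distrib_right
    by (subst sum.swap) (intro sum.cong refl, simp)
  also have "\<dots> = (\<Sum>c\<in>Pow {0..<x}. (-1) ^ card c * h (?F c))"
    using sub by (intro sum.cong refl) (simp add: sum.delta)
  finally show ?thesis by (simp add: mixed_diff_eq_sum)
qed

lemma mixed_diff_insert:
  assumes "\<And>S. h (insert e S) = h S"
  shows "mixed_diff a b k (insert e R) h = mixed_diff a b k R h"
  by (induction k arbitrary: R) (simp_all add: assms insert_commute[of _ e])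

text \<open>In the difference at column \<open>j\<close> the inserted entries can be deleted again,
  which makes the two terms equal.\<close>

lemma mixed_diff_eq_0:
  assumes "j < k" "\<And>S. h (insert (a j) S) = h S" "\<And>S. h (insert (b j) S) = h S"
  shows "mixed_diff a b k R h = 0"
  using assms(1)
proof (induction k arbitrary: R)
  case (Suc k)
  then show ?case using assms by (cases "j = k") (simp_all add: mixed_diff_insert)
qed simp

text \<open>Every set at which \<open>h\<close> is evaluated consists of \<open>R\<close> and one
  entry of each column; validity makes these entries distinct and keeps them below
  \<open>n\<close>.\<close>

lemma mixed_diff_eq_0_card:
  assumes "valid_tableau n k a b" "R \<subseteq> {0..<n}" "R \<inter> entries k a b = {}"
    and "\<And>S. S \<subseteq> {0..<n} \<Longrightarrow> card S = k + card R \<Longrightarrow> h S = 0"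
  shows "mixed_diff a b k R h = 0"
  using assms
proof (induction k arbitrary: R)
  case (Suc k)
  have "finite R" using Suc.prems(2) finite_subset by blast
  with Suc.prems have "mixed_diff a b k (insert (b k) R) h = 0" "mixed_diff a b k (insert (a k) R) h = 0"
    by (auto intro!: Suc.IH simp: valid_tableau_Suc_iff entries_Suc)
  then show ?case by simp
qed simp

text \<open>Split the subsets of \<open>insert e R\<close> by membership of \<open>e\<close>. Those
  without \<open>e\<close> cancel between the two entries of a column, so the surviving sets contain
  the chosen entry of every column and vary only inside \<open>R\<close>.\<close>

lemma mixed_diff_subset_sum:
  assumes "finite R" "valid_tableau n k a b" "R \<inter> entries k a b = {}"
  shows "mixed_diff a b k R (\<lambda>Y. \<Sum>T\<in>Pow Y. h T) = (\<Sum>Q\<in>Pow R. mixed_diff a b k Q h)"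
  using assms
proof (induction k arbitrary: R)
  case (Suc k)
  have split: "(\<Sum>Q\<in>Pow (insert e R). F Q) = (\<Sum>Q\<in>Pow R. F Q) + (\<Sum>Q\<in>Pow R. F (insert e Q))"
    if "e \<notin> R" for e and F :: "nat set \<Rightarrow> complex"
  proof -
    have "Pow R \<inter> insert e ` Pow R = {}" using that by auto
    moreover have "inj_on (insert e) (Pow R)"
      using that by (intro inj_onI) (metis Pow_iff insert_ident subsetD)
    ultimately show ?thesis
      using Suc.prems by (simp add: Pow_insert sum.union_disjoint sum.reindex)
  qed
  have "mixed_diff a b k (insert e R) (\<lambda>Y. \<Sum>T\<in>Pow Y. h T) = 
     (\<Sum>Q\<in>Pow (insert e R). mixed_diff a b k Q h)" if "e \<in> {a k, b k}" for e
    using Suc.prems that by (intro Suc.IH) (auto simp: valid_tableau_Suc_iff entries_Suc)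
  moreover have "a k \<notin> R" "b k \<notin> R"
    using Suc.prems by (auto simp: entries_Suc)
  ultimately show ?case
    by (simp add: split sum_subtractf)
qed simp

text \<open>The form \<open>Suc (card U) = x\<close> makes every function harmonic for
  \<open>x = 0\<close>, which starts the induction in the completeness proof. Only values on
  \<open>x\<close>-subsets are constrained, so the predicate also fits a function living on subsets
  of all sizes.\<close>

definition harmonic :: "nat \<Rightarrow> nat \<Rightarrow> (nat set \<Rightarrow> complex) \<Rightarrow> bool" where
  "harmonic n x h \<longleftrightarrow>
     (\<forall>U\<subseteq>{0..<n}. Suc (card U) = x \<longrightarrow> (\<Sum>e\<in>{0..<n} - U. h (insert e U)) = 0)"

text \<open>Each additional column removes two elements from the range of summation; the two
  missing summands are equal and enter with opposite signs.\<close>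

lemma harmonic_sum_mixed_diff:
  assumes "harmonic n x h" "valid_tableau n k a b" "R \<subseteq> {0..<n}" "R \<inter> entries k a b = {}"
    and "Suc (k + card R) = x"
  shows "(\<Sum>e\<in>{0..<n} - (entries k a b \<union> R). mixed_diff a b k (insert e R) h) = 0"
  using assms(2-)
proof (induction k arbitrary: R)
  case 0
  then show ?case using assms(1) by (simp add: harmonic_def)
next
  case (Suc k)
  have fin: "finite R" using Suc.prems(2) finite_subset by blast
  define F where "F = {0..<n} - (entries (Suc k) a b \<union> R)"
  have v: "valid_tableau n k a b" "a k < n" "b k < n" "a k \<noteq> b k"
     "a k \<notin> entries k a b" "b k \<notin> entries k a b" "a k \<notin> R" "b k \<notin> R"
    using Suc.prems by (auto simp: valid_tableau_Suc_iff entries_Suc)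
  have F: "a k \<notin> F" "b k \<notin> F" "finite F" by (auto simp: F_def entries_Suc)
  have Fb: "{0..<n} - (entries k a b \<union> insert (b k) R) = insert (a k) F"
    and Fa: "{0..<n} - (entries k a b \<union> insert (a k) R) = insert (b k) F"
    using v by (auto simp: F_def entries_Suc)
  have "(\<Sum>e\<in>insert (a k) F. mixed_diff a b k (insert e (insert (b k) R)) h) = 0"
    unfolding Fb[symmetric] using Suc.prems v fin
    by (intro Suc.IH) (auto simp: entries_Suc)
  moreover have "(\<Sum>e\<in>insert (b k) F. mixed_diff a b k (insert e (insert (a k) R)) h) = 0"
    unfolding Fa[symmetric] using Suc.prems v fin
    by (intro Suc.IH) (auto simp: entries_Suc)
  ultimately have "(\<Sum>e\<in>F. mixed_diff a b k (insert e (insert (b k) R)) h) =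
      (\<Sum>e\<in>F. mixed_diff a b k (insert e (insert (a k) R)) h)"
    using F by (simp add: insert_commute[of "a k" "b k"] add_eq_0_iff)
  then show ?case
    unfolding F_def[symmetric] by (simp add: sum_subtractf insert_commute)
qed

text \<open>The induction turns fixed elements into columns. Exchanging \<open>e\<close> in
  \<open>R\<close> for another free \<open>e'\<close> changes the value by a mixed difference with
  the extra column \<open>(e', e)\<close> and one fixed element less, which is zero by induction. So
  all summands of the harmonic relation are equal, and there is at least one, that of
  \<open>e\<close>.\<close>

lemma harmonic_mixed_diff_eq_0:
  assumes h: "harmonic n x h" and z: "\<And>a b. valid_tableau n x a b \<Longrightarrow> mixed_diff a b x {} h = 0"
    and "valid_tableau n k a b" "R \<subseteq> {0..<n}" "R \<inter> entries k a b = {}" "k + card R = x"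
  shows "mixed_diff a b k R h = 0"
  using assms(3-)
proof (induction "card R" arbitrary: R k a b)
  case 0
  then have "R = {}" using finite_subset by fastforce
  then show ?case using 0 z by simp
next
  case (Suc r)
  have fin: "finite R" using Suc.prems(2) finite_subset by blast
  then obtain e where e: "e \<in> R" using Suc.hyps(2) by fastforce
  define R0 where "R0 = R - {e}"
  have R0: "e \<notin> R0" "R = insert e R0" "R0 \<subseteq> {0..<n}" "R0 \<inter> entries k a b = {}" "card R0 = r"
    using e Suc fin by (auto simp: R0_def)
  define F where "F = {0..<n} - (entries k a b \<union> R0)"
  have eF: "e \<in> F" "finite F" using R0 Suc.prems e by (auto simp: F_def)
  have eq: "mixed_diff a b k (insert e' R0) h = mixed_diff a b k R h" if "e' \<in> F" for e'
  proof (cases "e' = e")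
    case False
    define a' b' where "a' = a(k := e')" and "b' = b(k := e)"
    have ent: "entries k a' b' = entries k a b"
      by (rule entries_cong) (auto simp: a'_def b'_def)
    have "valid_tableau n k a' b'"
      using Suc.prems(1) valid_tableau_cong[of k a' a b' b n] by (simp add: a'_def b'_def)
    then have v: "valid_tableau n (Suc k) a' b'"
      using that eF False by (simp add: valid_tableau_Suc_iff ent) (auto simp: a'_def b'_def F_def)
    have "entries (Suc k) a' b' = insert e' (insert e (entries k a b))"
      unfolding entries_Suc ent by (simp add: a'_def b'_def)
    then have "mixed_diff a' b' (Suc k) R0 h = 0"
      using Suc.hyps(2) Suc.prems(4) R0 v that
      by (intro Suc.hyps(1)) (auto simp: F_def)
    moreover have "mixed_diff a' b' k S h = mixed_diff a b k S h" for S
      by (rule mixed_diff_cong) (auto simp: a'_def b'_def)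
    ultimately show ?thesis
      by (simp add: a'_def b'_def R0(2))
  qed (simp add: R0)
  have "(\<Sum>e'\<in>F. mixed_diff a b k (insert e' R0) h) = 0"
    unfolding F_def using Suc R0 by (intro harmonic_sum_mixed_diff[OF h]) auto
  then have "of_nat (card F) * mixed_diff a b k R h = 0"
    using eq by simp
  then show ?case using eF by auto
qed

text \<open>With no columns at all, a mixed difference is a plain value of \<open>h\<close>.\<close>

lemma harmonic_eq_0:
  assumes "harmonic n x h" "\<And>a b. valid_tableau n x a b \<Longrightarrow> mixed_diff a b x {} h = 0"
    and "T \<subseteq> {0..<n}" "card T = x"
  shows "h T = 0"
  using harmonic_mixed_diff_eq_0[OF assms(1,2), of 0 _ _ T] assms(3,4) by simp

section \<open>Specht modules\<close>

lemma inj_on_column_choice: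
  assumes "valid_tableau n x a b"
  shows "inj_on (\<lambda>j. if P j then a j else b j) {0..<x}"
proof (rule inj_onI)
  fix i j assume ij: "i \<in> {0..<x}" "j \<in> {0..<x}"
    "(if P i then a i else b i) = (if P j then a j else b j)"
  have *: "inj_on a {0..<x}" "inj_on b {0..<x}" and ne: "a ` {0..<x} \<inter> b ` {0..<x} = {}"
    using assms by (auto simp: valid_tableau_iff)
  have "a i \<noteq> b j" "a j \<noteq> b i" using ne ij by blast+
  then show "i = j"
    using ij inj_onD[OF *(1), of i j] inj_onD[OF *(2), of i j] by (auto split: if_splits)
qed

lemma polytabloid_in_tabloid_space:
  assumes "valid_tableau n x a b"
  shows "polytabloid x a b \<in> tabloid_space n x"
proof -
  have sub: "(\<lambda>j. if j \<in> c then a j else b j) ` {0..<x} \<subseteq> {0..<n}" for c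
    using assms by (auto simp: valid_tableau_def)
  have card: "card ((\<lambda>j. if j \<in> c then a j else b j) ` {0..<x}) = x" for c
    using card_image[OF inj_on_column_choice[OF assms, of "\<lambda>j. j \<in> c"]] by simp
  have "polytabloid x a b T = 0" if "\<not> (T \<subseteq> {0..<n} \<and> card T = x)" for T
  proof -
    have "T \<noteq> (\<lambda>j. if j \<in> c then a j else b j) ` {0..<x}" for c
      using sub[of c] card[of c] that by blast
    then show ?thesis unfolding polytabloid_def by simp
  qed
  then show ?thesis
    unfolding tabloid_space_def by simp
qed

text \<open>Since \<open>U\<close> has fewer than \<open>x\<close> elements, it misses both entries of some column, and
  exchanging these entries reverses the sign.\<close>

lemma harmonic_polytabloid:
  assumes v: "valid_tableau n x a b"
  shows "harmonic n x (polytabloid x a b)"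
  unfolding harmonic_def
proof (intro allI impI)
  fix U assume U: "U \<subseteq> {0..<n}" "Suc (card U) = x"
  have fin: "finite U" using U(1) finite_subset by blast
  let ?E = "polytabloid x a b"
  \<comment> \<open>Pairing the polytabloid with this indicator gives the sum over the supersets of
    \<open>U\<close>, and the indicator ignores both entries of a column that is disjoint from
    \<open>U\<close>.\<close>
  let ?h = "\<lambda>T. if U \<subseteq> T then 1 else 0 :: complex"
  have "\<exists>j<x. a j \<notin> U \<and> b j \<notin> U"
  proof (rule ccontr)
    assume "\<not> ?thesis"
    then have "(\<lambda>j. if a j \<in> U then a j else b j) ` {0..<x} \<subseteq> U" by auto
    then have "x \<le> card U"
      using card_inj_on_le[OF inj_on_column_choice[OF v, of "\<lambda>j. a j \<in> U"]] fin by fastforce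
    then show False using U by simp
  qed
  then obtain j where j: "j < x" "a j \<notin> U" "b j \<notin> U" by blast
  then have "mixed_diff a b x {} ?h = 0"
    by (intro mixed_diff_eq_0[of j]) (auto simp: subset_insert)
  then have 0: "(\<Sum>T\<in>Pow {0..<n}. ?E T * ?h T) = 0"
    by (simp add: sum_polytabloid_eq_mixed_diff[OF v])
  have inj: "inj_on (\<lambda>e. insert e U) ({0..<n} - U)"
    by (rule inj_onI) blast
  have "(\<Sum>e\<in>{0..<n} - U. ?E (insert e U)) = (\<Sum>T\<in>(\<lambda>e. insert e U) ` ({0..<n} - U). ?E T * ?h T)"
    by (subst sum.reindex[OF inj]) (auto intro!: sum.cong)
  also have "\<dots> = (\<Sum>T\<in>Pow {0..<n}. ?E T * ?h T)"
  proof (rule sum.mono_neutral_left)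
    show "\<forall>T\<in>Pow {0..<n} - (\<lambda>e. insert e U) ` ({0..<n} - U). ?E T * ?h T = 0"
    proof
      fix T assume T: "T \<in> Pow {0..<n} - (\<lambda>e. insert e U) ` ({0..<n} - U)"
      have "\<not> U \<subseteq> T" if "card T = x"
      proof
        assume "U \<subseteq> T"
        have finT: "finite T" using T finite_subset by auto
        with \<open>U \<subseteq> T\<close> that U fin have "card (T - U) = 1" by (simp add: card_Diff_subset)
        then obtain e where "T - U = {e}" by (auto simp: card_1_singleton_iff)
        then have "T = insert e U" "e \<in> {0..<n} - U" using \<open>U \<subseteq> T\<close> T by auto
        then show False using T by auto
      qed
      then show "?E T * ?h T = 0"
        using polytabloid_in_tabloid_space[OF v] by (cases "card T = x") (auto simp: tabloid_space_def)
    qed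
  qed (use U in auto)
  finally show "(\<Sum>e\<in>{0..<n} - U. ?E (insert e U)) = 0" using 0 by simp
qed

lemma lin_subspace_specht: "lin_subspace (specht n x)"
  by (simp add: specht_def lin_subspace_cspan)

lemma specht_subset: "specht n x \<subseteq> {g \<in> tabloid_space n x. harmonic n x g}"
  unfolding specht_def
proof (rule cspan_minimal)
  show "lin_subspace {g \<in> tabloid_space n x. harmonic n x g}"
    unfolding lin_subspace_def harmonic_def tabloid_space_def cadd_def cscale_def
    by (auto simp: sum.distrib sum_distrib_left[symmetric])
qed (auto simp: polytabloid_in_tabloid_space harmonic_polytabloid)

lemma polytabloid_in_specht: "valid_tableau n x a b \<Longrightarrow> polytabloid x a b \<in> specht n x"
  unfolding specht_def by (rule subsetD[OF cspan_superset]) blast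

section \<open>Invariance of Specht modules under permutations\<close>

lemma act_M_polytabloid:
  assumes "\<sigma> permutes {0..<n}"
  shows "act_M \<sigma> (polytabloid x a b) = polytabloid x (\<sigma> \<circ> a) (\<sigma> \<circ> b)"
proof
  fix T
  have bij: "bij \<sigma>" using assms by (rule permutes_bij)
  have "\<sigma> -` T = (\<lambda>j. if j \<in> c then a j else b j) ` {0..<x} \<longleftrightarrow>
      T = (\<lambda>j. if j \<in> c then (\<sigma> \<circ> a) j else (\<sigma> \<circ> b) j) ` {0..<x}" for c
  proof -
    have "\<sigma> -` T = A \<longleftrightarrow> T = \<sigma> ` A" for A
      using inj_vimage_image_eq[OF bij_is_inj[OF bij]] surj_image_vimage_eq[OF bij_is_surj[OF bij]]
      by metis
    moreover have "\<sigma> ` (\<lambda>j. if j \<in> c then a j else b j) ` {0..<x} =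
        (\<lambda>j. if j \<in> c then (\<sigma> \<circ> a) j else (\<sigma> \<circ> b) j) ` {0..<x}"
      unfolding image_image by (rule image_cong) auto
    ultimately show ?thesis by simp
  qed
  then show "act_M \<sigma> (polytabloid x a b) T = polytabloid x (\<sigma> \<circ> a) (\<sigma> \<circ> b) T"
    by (simp add: act_M_def polytabloid_def)
qed

lemma valid_tableau_permutes:
  assumes "\<sigma> permutes {0..<n}" "valid_tableau n x a b"
  shows "valid_tableau n x (\<sigma> \<circ> a) (\<sigma> \<circ> b)"
proof -
  have inj: "inj \<sigma>" using assms(1) by (rule permutes_inj)
  have "\<sigma> i < n" if "i < n" for i
    using permutes_in_image[OF assms(1), of i] that by simp
  moreover have "inj_on (\<lambda>j. if j < x then (\<sigma> \<circ> a) j else (\<sigma> \<circ> b) (j - x)) {0..<2*x}"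
  proof -
    have "inj_on (\<sigma> \<circ> (\<lambda>j. if j < x then a j else b (j - x))) {0..<2*x}"
      using assms(2) inj by (intro comp_inj_on) (auto simp: valid_tableau_def intro: inj_on_subset)
    then show ?thesis by (simp add: o_def if_distrib cong: if_cong)
  qed
  ultimately show ?thesis using assms(2) by (simp add: valid_tableau_def)
qed

lemma act_M_specht:
  assumes "\<sigma> permutes {0..<n}" "g \<in> specht n x"
  shows "act_M \<sigma> g \<in> specht n x"
proof -
  have "cspan {polytabloid x a b | a b. valid_tableau n x a b} \<subseteq> {g. act_M \<sigma> g \<in> specht n x}"
  proof (rule cspan_minimal)
    show "lin_subspace {g. act_M \<sigma> g \<in> specht n x}"
      using lin_subspace_specht[of n x]
      unfolding lin_subspace_def act_M_def cadd_def cscale_def by auto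
    show "{polytabloid x a b | a b. valid_tableau n x a b} \<subseteq> {g. act_M \<sigma> g \<in> specht n x}"
      by (auto simp: act_M_polytabloid[OF assms(1)] intro!: polytabloid_in_specht
          valid_tableau_permutes[OF assms(1)])
  qed
  then show ?thesis using assms(2) unfolding specht_def[symmetric] by blast
qed

text \<open>The eigenvalue of the sum over all ordered pairs \<open>(i, j)\<close> of the transpositions
  \<open>(i j)\<close>, where \<open>i = j\<close> contributes the identity.\<close>

definition transposition_eigenvalue :: "nat \<Rightarrow> nat \<Rightarrow> real" where
  "transposition_eigenvalue n x = (real x)\<^sup>2 + (real n - real x)\<^sup>2 - 2 * real x"

text \<open>For an \<open>x\<close>-subset \<open>T\<close>, swaps of two elements on the same side
  of \<open>T\<close> fix it and contribute x^2 + (n-x)^2. For \<open>i\<close> in \<open>T\<close>,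
  the swaps with all elements outside replace \<open>i\<close> by each of them; harmonicity at
  \<open>T - {i}\<close>, whose sum also contains \<open>g T\<close>, makes them add up to
  \<open>- g T\<close>. There are x such \<open>i\<close>, each counted for both orders of the
  pair.\<close>

lemma harmonic_sum_transpositions:
  assumes g: "g \<in> tabloid_space n x" "harmonic n x g"
  shows "(\<Sum>i\<in>{0..<n}. \<Sum>j\<in>{0..<n}. act_M (transpose i j) g T) =
           of_real (transposition_eigenvalue n x) * g T"
proof (cases "T \<subseteq> {0..<n} \<and> card T = x")
  case False
  have "act_M (transpose i j) g T = 0" if "i < n" "j < n" for i j
  proof -
    have p: "transpose i j permutes {0..<n}" using that by (intro permutes_swap_id) auto
    have "card (transpose i j -` T) = card T"
      by (intro card_vimage_inj) auto
    moreover have "transpose i j -` T \<subseteq> {0..<n} \<longleftrightarrow> T \<subseteq> {0..<n}"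
      using permutes_in_image[OF p] by (metis bij_is_surj bij_transpose permutes_vimage[OF p]
          surj_image_vimage_eq vimage_mono permutes_image[OF p] image_mono)
    ultimately show ?thesis using False g by (simp add: act_M_def tabloid_space_def)
  qed
  then show ?thesis using False g by (simp add: tabloid_space_def)
next
  case True
  define C where "C = {0..<n} - T"
  have T: "T \<subseteq> {0..<n}" "card T = x" "finite T" using True finite_subset by auto
  have n: "{0..<n} = T \<union> C" "T \<inter> C = {}" "finite C" using T by (auto simp: C_def)
  have le: "x \<le> n" using card_mono[of "{0..<n}" T] T by simp
  have card_C: "card C = n - x" using T by (simp add: C_def card_Diff_subset)
  have split: "(\<Sum>i\<in>{0..<n}. F i) = (\<Sum>i\<in>T. F i) + (\<Sum>i\<in>C. F i)" for F :: "nat \<Rightarrow> complex"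
    unfolding n(1) using T n by (intro sum.union_disjoint) auto
  have exch: "(\<Sum>j\<in>C. g (insert j (T - {i}))) = - g T" if "i \<in> T" for i
  proof -
    have "Suc (card (T - {i})) = x" using T that by (metis card_Suc_Diff1)
    then have "(\<Sum>e\<in>{0..<n} - (T - {i}). g (insert e (T - {i}))) = 0"
      using g(2) T(1) unfolding harmonic_def by blast
    moreover have "{0..<n} - (T - {i}) = insert i C" using T that by (auto simp: C_def)
    moreover have "i \<notin> C" using that by (auto simp: C_def)
    ultimately show ?thesis
      using n that by (simp add: insert_absorb add_eq_0_iff2)
  qed
  have same: "transpose i j -` T = T" if "i \<in> T \<longleftrightarrow> j \<in> T" for i j
    using that by (auto simp: transpose_def split: if_splits)
  have diff: "transpose i j -` T = insert j (T - {i})" "transpose j i -` T = insert j (T - {i})"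
    if "i \<in> T" "j \<notin> T" for i j
    using that by (auto simp: transpose_def split: if_splits)
  have TT: "(\<Sum>i\<in>T. \<Sum>j\<in>T. act_M (transpose i j) g T) = of_nat (x * x) * g T"
    by (simp add: act_M_def same T)
  have CC: "(\<Sum>i\<in>C. \<Sum>j\<in>C. act_M (transpose i j) g T) = of_nat ((n - x) * (n - x)) * g T"
  proof -
    have "act_M (transpose i j) g T = g T" if "i \<in> C" "j \<in> C" for i j
      using that same[of i j] by (simp add: act_M_def C_def)
    then show ?thesis by (simp add: card_C)
  qed
  have TC: "(\<Sum>i\<in>T. \<Sum>j\<in>C. act_M (transpose i j) g T) = - of_nat x * g T"
  proof -
    have "(\<Sum>j\<in>C. act_M (transpose i j) g T) = - g T" if "i \<in> T" for i
      unfolding exch[OF that, symmetric] using that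
      by (intro sum.cong) (auto simp: act_M_def diff C_def)
    then show ?thesis by (simp add: T)
  qed
  have CT: "(\<Sum>i\<in>C. \<Sum>j\<in>T. act_M (transpose i j) g T) = - of_nat x * g T"
    unfolding TC[symmetric] by (subst sum.swap) (simp add: transpose_commute)
  have sum: "(\<Sum>i\<in>{0..<n}. \<Sum>j\<in>{0..<n}. act_M (transpose i j) g T) =
      of_nat (x * x) * g T + - of_nat x * g T +
      (- of_nat x * g T + of_nat ((n - x) * (n - x)) * g T)"
    by (simp only: split sum.distrib TT TC CT CC)
  obtain k where "n = x + k" using le le_Suc_ex by blast
  then show ?thesis
    unfolding sum by (simp add: transposition_eigenvalue_def power2_eq_square algebra_simps)
qed

section \<open>Embedding Specht modules into the tensor space\<close>

definition bits :: "nat \<Rightarrow> nat set \<Rightarrow> bool list" where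
  "bits n Y = map (\<lambda>i. i \<in> Y) [0..<n]"

definition ones :: "bool list \<Rightarrow> nat set" where
  "ones s = {i. i < length s \<and> s ! i}"

lemma length_bits [simp]: "length (bits n Y) = n"
  by (simp add: bits_def)

lemma ones_subset: "ones s \<subseteq> {0..<length s}"
  by (auto simp: ones_def)

lemma finite_ones [simp]: "finite (ones s)"
  using ones_subset finite_subset by blast

lemma ones_bits: "Y \<subseteq> {0..<n} \<Longrightarrow> ones (bits n Y) = Y"
  by (auto simp: ones_def bits_def)

lemma bits_ones: "length s = n \<Longrightarrow> bits n (ones s) = s"
  by (auto simp: ones_def bits_def intro: nth_equalityI)

lemma bij_betw_bits: "bij_betw (bits n) (Pow {0..<n}) (strings n)"
  by (rule bij_betw_byWitness[where f' = ones])
    (use ones_subset in \<open>auto simp: ones_bits bits_ones strings_def\<close>)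

lemma tinner_eq_sum_sets:
  "tinner n f g = (\<Sum>Y\<in>Pow {0..<n}. cnj (f (bits n Y)) * g (bits n Y))"
  unfolding tinner_def by (rule sum.reindex_bij_betw[OF bij_betw_bits, symmetric])

text \<open>For \<open>g\<close> supported on \<open>x\<close>-subsets this is the incidence map to
  \<open>m\<close>-subsets, a divided power of the sl_2 raising operator.\<close>

definition embed :: "nat \<Rightarrow> nat \<Rightarrow> (nat set \<Rightarrow> complex) \<Rightarrow> (bool list \<Rightarrow> complex)" where
  "embed n m g = (\<lambda>s. if length s = n \<and> card (ones s) = m then \<Sum>T\<in>Pow (ones s). g T else 0)"

lemma embed_cadd: "embed n m (cadd f g) = cadd (embed n m f) (embed n m g)"
  by (auto simp: embed_def cadd_def sum.distrib)

lemma embed_cscale: "embed n m (cscale c f) = cscale c (embed n m f)"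
  by (auto simp: embed_def cscale_def sum_distrib_left)

text \<open>It suffices that \<open>g\<close> is orthogonal to every polytabloid. Fix
  \<open>m - x\<close> elements \<open>R\<close> outside the tableau, for which
  \<open>m + x \<le> n\<close> leaves room. The subset sums of \<open>g\<close> vanish on all
  \<open>m\<close>-sets, hence so does their mixed difference over \<open>R\<close>; it expands into
  mixed differences of \<open>g\<close> over \<open>Q \<subseteq> R\<close>, and for nonempty
  \<open>Q\<close> these see only sets with more than \<open>x\<close> elements.\<close>

lemma embed_eq_0:
  assumes g: "g \<in> tabloid_space n x" "harmonic n x g" and m: "x \<le> m" "m + x \<le> n"
    and 0: "embed n m g = (\<lambda>_. 0)"
  shows "g = (\<lambda>_. 0)"
proof
  fix T
  have supp: "g S = 0" if "\<not> (S \<subseteq> {0..<n} \<and> card S = x)" for S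
    using g(1) that unfolding tabloid_space_def by blast
  have z: "(\<Sum>T\<in>Pow S. g T) = 0" if "S \<subseteq> {0..<n}" "card S = m" for S
    using fun_cong[OF 0, of "bits n S"] that by (simp add: embed_def ones_bits)
  have "mixed_diff a b x {} g = 0" if v: "valid_tableau n x a b" for a b
  proof -
    have ent: "entries x a b \<subseteq> {0..<n}" using v by (simp add: valid_tableau_iff)
    have "card (entries x a b) \<le> card (a ` {0..<x}) + card (b ` {0..<x})"
      unfolding entries_def by (rule card_Un_le)
    also have "\<dots> \<le> x + x"
      using card_image_le[of "{0..<x}" a] card_image_le[of "{0..<x}" b] by simp
    finally have "m - x \<le> card ({0..<n} - entries x a b)"
      using m ent by (simp add: card_Diff_subset)
    then obtain R where R: "R \<subseteq> {0..<n} - entries x a b" "card R = m - x" "finite R"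
      by (rule obtain_subset_with_card_n)
    have Rd: "R \<subseteq> {0..<n}" "R \<inter> entries x a b = {}" using R by auto
    have "mixed_diff a b x R (\<lambda>Y. \<Sum>T\<in>Pow Y. g T) = 0"
      using m R z by (intro mixed_diff_eq_0_card[OF v Rd]) simp
    then have "0 = (\<Sum>Q\<in>Pow R. mixed_diff a b x Q g)"
      by (simp add: mixed_diff_subset_sum[OF R(3) v Rd(2)])
    also have "\<dots> = (\<Sum>Q\<in>{{}}. mixed_diff a b x Q g)"
    proof (rule sum.mono_neutral_right)
      show "\<forall>Q\<in>Pow R - {{}}. mixed_diff a b x Q g = 0"
      proof
        fix Q assume Q: "Q \<in> Pow R - {{}}"
        then have "finite Q" using R(3) finite_subset by auto
        then have "card Q \<noteq> 0" using Q by auto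
        then show "mixed_diff a b x Q g = 0"
          using Q Rd by (intro mixed_diff_eq_0_card[OF v] supp) auto
      qed
    qed (use R in auto)
    finally show ?thesis by simp
  qed
  then show "g T = 0"
    using harmonic_eq_0[OF g(2)] supp by blast
qed

lemma ones_permute:
  assumes "\<sigma> permutes {0..<n}" "length s = n"
  shows "ones (map (\<lambda>i. s ! \<sigma> i) [0..<n]) = \<sigma> -` ones s"
proof -
  have "\<sigma> i < n \<longleftrightarrow> i < n" for i
    using permutes_in_image[OF assms(1), of i] by simp
  then show ?thesis
    using assms(2) unfolding ones_def by fastforce
qed

lemma act_V_embed:
  assumes "\<sigma> permutes {0..<n}"
  shows "act_V n \<sigma> (embed n m g) = embed n m (act_M \<sigma> g)"
proof
  fix s
  have bij: "bij \<sigma>" using assms by (rule permutes_bij)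
  show "act_V n \<sigma> (embed n m g) s = embed n m (act_M \<sigma> g) s"
  proof (cases "length s = n")
    case True
    have "card (\<sigma> -` ones s) = card (ones s)"
      using bij by (intro card_vimage_inj) (auto simp: bij_def)
    moreover have "(\<Sum>T\<in>Pow (\<sigma> -` ones s). g T) = (\<Sum>T\<in>Pow (ones s). g (\<sigma> -` T))"
      using inj_vimage_image_eq[OF bij_is_inj[OF bij]] surj_image_vimage_eq[OF bij_is_surj[OF bij]]
      by (intro sum.reindex_bij_witness[of _ "vimage \<sigma>" "image \<sigma>"]) auto
    ultimately show ?thesis
      using True by (simp add: act_V_def embed_def ones_permute[OF assms] act_M_def)
  qed (simp add: act_V_def embed_def)
qed

text \<open>The embedding itself is the isomorphism demanded by \<open>isotypic\<close>. This
  provides concrete elements of the component in weight \<open>m\<close>, against which a vector can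
  be tested.\<close>

lemma embed_specht_subset_isotypic:
  assumes m: "x \<le> m" "m + x \<le> n"
  shows "embed n m ` specht n x \<subseteq> isotypic n x"
proof -
  let ?U = "embed n m ` specht n x"
  note S = lin_subspace_specht[of n x]
  have lin: "lin_subspace ?U"
  proof -
    have "(\<lambda>_. 0) \<in> ?U"
      using lin_subspace_zero[OF S] by (rule rev_image_eqI) (simp add: embed_def fun_eq_iff)
    moreover have "cadd f g \<in> ?U" if "f \<in> ?U" "g \<in> ?U" for f g
      using that lin_subspace_cadd[OF S] by (auto simp: embed_cadd[symmetric])
    moreover have "cscale c f \<in> ?U" if "f \<in> ?U" for f c
      using that lin_subspace_cscale[OF S] by (auto simp: embed_cscale[symmetric])
    ultimately show ?thesis by (simp add: lin_subspace_def)
  qed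
  have "inj_on (embed n m) (specht n x)"
  proof (rule inj_onI)
    fix f g assume fg: "f \<in> specht n x" "g \<in> specht n x" "embed n m f = embed n m g"
    have "csub f g \<in> specht n x" using fg by (intro lin_subspace_csub S)
    then have "csub f g \<in> tabloid_space n x" "harmonic n x (csub f g)"
      using specht_subset by blast+
    moreover have "embed n m (csub f g) = (\<lambda>_. 0)"
      using fg(3) by (simp add: csub_eq_cadd embed_cadd embed_cscale) (simp add: cadd_def cscale_def)
    ultimately have "csub f g = (\<lambda>_. 0)" using m by (intro embed_eq_0)
    then show "f = g" by (simp add: csub_def fun_eq_iff)
  qed
  then have "equivariant_iso n x (embed n m) ?U"
    unfolding equivariant_iso_def
    by (auto simp: bij_betw_def embed_cadd embed_cscale act_V_embed)
  moreover have "?U \<subseteq> tensor_space n"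
    by (auto simp: tensor_space_def embed_def)
  moreover have "act_V n \<sigma> f \<in> ?U" if "\<sigma> permutes {0..<n}" "f \<in> ?U" for \<sigma> f
    using that by (auto simp: act_V_embed act_M_specht)
  ultimately show ?thesis
    using lin unfolding isotypic_def by (intro order.trans[OF _ cspan_superset]) blast
qed

section \<open>Isotypic components as eigenspaces\<close>

lemma tinner_eq_inner_on: "tinner n = inner_on (strings n)"
  by (simp add: fun_eq_iff tinner_def inner_on_def)

lemma finite_strings: "finite (strings n)"
  using bij_betw_finite[OF bij_betw_bits, of n] by simp

lemma inner_on_sum_right: "inner_on S f (\<lambda>s. \<Sum>i\<in>I. g i s) = (\<Sum>i\<in>I. inner_on S f (g i))"
  unfolding inner_on_def sum_distrib_left by (rule sum.swap)

lemma inner_on_sum_left: "inner_on S (\<lambda>s. \<Sum>i\<in>I. g i s) f = (\<Sum>i\<in>I. inner_on S (g i) f)"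
  unfolding inner_on_def cnj_sum sum_distrib_right by (rule sum.swap)

lemma lin_subspace_isotypic: "lin_subspace (isotypic n x)"
  by (simp add: isotypic_def lin_subspace_cspan)

lemma isotypic_subset_tensor_space: "isotypic n x \<subseteq> tensor_space n"
proof -
  have "lin_subspace (tensor_space n)"
    by (auto simp: lin_subspace_def tensor_space_def cadd_def cscale_def)
  then show ?thesis
    unfolding isotypic_def by (intro cspan_minimal) auto
qed

text \<open>As the pairs are ordered and \<open>i = j\<close> is allowed, on the tensor space this
  is twice the sum of all transpositions plus \<open>n\<close> times the identity, the action of a
  central element of the group algebra.\<close>

definition transposition_sum :: "nat \<Rightarrow> (bool list \<Rightarrow> complex) \<Rightarrow> (bool list \<Rightarrow> complex)" where
  "transposition_sum n f = (\<lambda>s. \<Sum>i\<in>{0..<n}. \<Sum>j\<in>{0..<n}. act_V n (transpose i j) f s)"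

lemma transpose_permutes_lessThan: "i \<in> {0..<n} \<Longrightarrow> j \<in> {0..<n} \<Longrightarrow> transpose i j permutes {0..<n}"
  by (rule permutes_swap_id)

text \<open>\<open>\<phi>\<close> is linear and equivariant only on \<open>specht n x\<close>, so
  each partial sum is shown to stay there before \<open>\<phi>\<close> is pulled through it. The
  scalar then comes from harmonicity of \<open>g\<close>.\<close>

lemma transposition_sum_equivariant_iso:
  assumes \<phi>: "equivariant_iso n x \<phi> U" and g: "g \<in> specht n x"
  shows "transposition_sum n (\<phi> g) = cscale (of_real (transposition_eigenvalue n x)) (\<phi> g)"
proof -
  let ?I = "{0..<n}"
  note S = lin_subspace_specht[of n x]
  have add: "\<phi> (cadd f h) = cadd (\<phi> f) (\<phi> h)" if "f \<in> specht n x" "h \<in> specht n x" for f h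
    using \<phi> that by (simp add: equivariant_iso_def)
  have scale: "\<phi> (cscale c f) = cscale c (\<phi> f)" if "f \<in> specht n x" for f c
    using \<phi> that by (simp add: equivariant_iso_def)
  have act: "act_V n (transpose i j) (\<phi> g) = \<phi> (act_M (transpose i j) g)" "act_M (transpose i j) g \<in> specht n x"
    if "i \<in> ?I" "j \<in> ?I" for i j
    using \<phi> g act_M_specht transpose_permutes_lessThan[OF that] by (auto simp: equivariant_iso_def)
  have \<phi>_sum: "\<phi> (\<lambda>T. \<Sum>i\<in>I. F i T) = (\<lambda>s. \<Sum>i\<in>I. \<phi> (F i) s)"
    if "finite I" "\<And>i. i \<in> I \<Longrightarrow> F i \<in> specht n x" for I :: "nat set" and F
    using that
  proof (induction I)
    case empty
    \<comment> \<open>Homogeneity with the scalar 0 supplies the value of \<open>\<phi>\<close> at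
      the zero function.\<close>
    have "\<phi> (cscale 0 g) = cscale 0 (\<phi> g)" using g by (rule scale)
    then show ?case by (simp add: cscale_def)
  next
    case (insert i I)
    then have "\<phi> (cadd (F i) (\<lambda>T. \<Sum>i\<in>I. F i T)) = cadd (\<phi> (F i)) (\<phi> (\<lambda>T. \<Sum>i\<in>I. F i T))"
      by (intro add lin_subspace_sum[OF S]) auto
    with insert show ?case by (simp add: cadd_def)
  qed
  have row: "\<phi> (\<lambda>T. \<Sum>j\<in>?I. act_M (transpose i j) g T) = (\<lambda>s. \<Sum>j\<in>?I. \<phi> (act_M (transpose i j) g) s)"
    if "i \<in> ?I" for i
    by (rule \<phi>_sum) (use act that in auto)
  have "transposition_sum n (\<phi> g) = (\<lambda>s. \<Sum>i\<in>?I. \<Sum>j\<in>?I. \<phi> (act_M (transpose i j) g) s)"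
    unfolding transposition_sum_def by (intro ext sum.cong refl) (simp add: act)
  also have "\<dots> = (\<lambda>s. \<Sum>i\<in>?I. \<phi> (\<lambda>T. \<Sum>j\<in>?I. act_M (transpose i j) g T) s)"
    by (intro ext sum.cong refl) (simp add: row)
  also have "\<dots> = \<phi> (\<lambda>T. \<Sum>i\<in>?I. \<Sum>j\<in>?I. act_M (transpose i j) g T)"
    by (rule \<phi>_sum[symmetric]) (auto intro!: lin_subspace_sum[OF S] act(2))
  also have "(\<lambda>T. \<Sum>i\<in>?I. \<Sum>j\<in>?I. act_M (transpose i j) g T) =
      cscale (of_real (transposition_eigenvalue n x)) g"
    using g specht_subset harmonic_sum_transpositions[of g n x] unfolding cscale_def by blast
  finally show ?thesis using g by (simp add: scale)
qed

lemma transposition_sum_linear: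
  "transposition_sum n (cadd f g) = cadd (transposition_sum n f) (transposition_sum n g)"
  "transposition_sum n (cscale c f) = cscale c (transposition_sum n f)"
  "transposition_sum n (\<lambda>s. \<Sum>k\<in>K. F k s) = (\<lambda>s. \<Sum>k\<in>K. transposition_sum n (F k) s)"
proof -
  show "transposition_sum n (cadd f g) = cadd (transposition_sum n f) (transposition_sum n g)"
    unfolding transposition_sum_def cadd_def sum.distrib[symmetric]
    by (intro ext sum.cong refl) (simp add: act_V_def)
  show "transposition_sum n (cscale c f) = cscale c (transposition_sum n f)"
    unfolding transposition_sum_def cscale_def sum_distrib_left
    by (intro ext sum.cong refl) (simp add: act_V_def)
  have "act_V n \<sigma> (\<lambda>s. \<Sum>k\<in>K. F k s) s = (\<Sum>k\<in>K. act_V n \<sigma> (F k) s)" for \<sigma> s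
    by (simp add: act_V_def)
  then show "transposition_sum n (\<lambda>s. \<Sum>k\<in>K. F k s) = (\<lambda>s. \<Sum>k\<in>K. transposition_sum n (F k) s)"
    unfolding transposition_sum_def by (simp only: sum.swap[of _ _ K])
qed

lemma transposition_sum_isotypic:
  assumes "f \<in> isotypic n x"
  shows "transposition_sum n f = cscale (of_real (transposition_eigenvalue n x)) f"
proof -
  let ?E = "{f. transposition_sum n f = cscale (of_real (transposition_eigenvalue n x)) f}"
  have "isotypic n x \<subseteq> ?E"
    unfolding isotypic_def
  proof (rule cspan_minimal)
    have "transposition_sum n (\<lambda>_. 0) = (\<lambda>_. 0)"
      by (simp add: transposition_sum_def act_V_def)
    then show "lin_subspace ?E"
      by (auto simp: lin_subspace_def transposition_sum_linear)
        (auto simp: cscale_def cadd_def algebra_simps)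
    have "U \<subseteq> ?E" if iso: "equivariant_iso n x \<phi> U" for \<phi> U
    proof
      fix f assume "f \<in> U"
      then obtain g where "g \<in> specht n x" "f = \<phi> g"
        using iso by (auto simp: equivariant_iso_def bij_betw_def)
      then show "f \<in> ?E" using transposition_sum_equivariant_iso[OF iso] by simp
    qed
    then show "\<Union>{U. U \<subseteq> tensor_space n \<and> lin_subspace U \<and>
       (\<forall>\<sigma> f. \<sigma> permutes {0..<n} \<longrightarrow> f \<in> U \<longrightarrow> act_V n \<sigma> f \<in> U) \<and>
       (\<exists>\<phi>. equivariant_iso n x \<phi> U)} \<subseteq> ?E" by blast
  qed
  then show ?thesis using assms by blast
qed

lemma act_V_bits:
  assumes "\<sigma> permutes {0..<n}"
  shows "act_V n \<sigma> f (bits n Y) = f (bits n (\<sigma> -` Y))"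
proof -
  have "\<sigma> i < n" if "i < n" for i
    using permutes_in_image[OF assms, of i] that by simp
  then have "map (\<lambda>i. bits n Y ! \<sigma> i) [0..<n] = bits n (\<sigma> -` Y)"
    by (auto simp: bits_def)
  then show ?thesis by (simp add: act_V_def)
qed

lemma tinner_act_V_transpose:
  assumes "i \<in> {0..<n}" "j \<in> {0..<n}"
  shows "tinner n (act_V n (transpose i j) f) g = tinner n f (act_V n (transpose i j) g)"
proof -
  note p = transpose_permutes_lessThan[OF assms]
  have sub: "transpose i j -` Y \<subseteq> {0..<n}" if "Y \<subseteq> {0..<n}" for Y
    using vimage_mono[OF that, of "transpose i j"] permutes_vimage[OF p] by simp
  have inv: "transpose i j -` transpose i j -` Y = Y" for Y
    by (simp add: vimage_def)
  show ?thesis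
    unfolding tinner_eq_sum_sets act_V_bits[OF p]
    by (rule sum.reindex_bij_witness[of _ "vimage (transpose i j)" "vimage (transpose i j)"])
      (use sub in \<open>auto simp: inv\<close>)
qed

lemma tinner_transposition_sum:
  "tinner n (transposition_sum n f) g = tinner n f (transposition_sum n g)"
  using tinner_act_V_transpose[of _ n _ f g]
  by (simp add: transposition_sum_def tinner_eq_inner_on inner_on_sum_left inner_on_sum_right)

section \<open>Separation of the eigenvalues, orthogonality and projections\<close>

lemma transposition_eigenvalue_inj:
  assumes "2 * x \<le> n" "2 * y \<le> n" "x \<noteq> y"
  shows "transposition_eigenvalue n x \<noteq> transposition_eigenvalue n y"
proof
  assume "transposition_eigenvalue n x = transposition_eigenvalue n y"
  \<comment> \<open>Since \<open>x + y \<le> n\<close>, the second factor is at most -1.\<close>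
  then have "(real x - real y) * (real x + real y - real n - 1) = 0"
    by (simp add: transposition_eigenvalue_def power2_eq_square algebra_simps)
  then show False using assms by auto
qed

lemma isotypic_orthogonal:
  assumes "2 * x \<le> n" "2 * y \<le> n" "x \<noteq> y" "f \<in> isotypic n x" "g \<in> isotypic n y"
  shows "tinner n f g = 0"
proof -
  have "of_real (transposition_eigenvalue n x) * tinner n f g =
      of_real (transposition_eigenvalue n y) * tinner n f g"
    using tinner_transposition_sum[of n f g]
    by (simp add: transposition_sum_isotypic[OF assms(4)] transposition_sum_isotypic[OF assms(5)]
        tinner_eq_inner_on inner_on_linear)
  then show ?thesis
    using transposition_eigenvalue_inj[OF assms(1-3)] by simp
qed

text \<open>Resolves the definite description. For uniqueness, the difference of two candidates lies
  in \<open>W\<close> and is orthogonal to itself; off \<open>strings n\<close> it vanishes because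
  \<open>W\<close> lies in the tensor space.\<close>

lemma oproj_properties:
  assumes "lin_subspace W" "W \<subseteq> tensor_space n"
  shows "oproj n W v \<in> W" "\<And>u. u \<in> W \<Longrightarrow> tinner n u (csub v (oproj n W v)) = 0"
proof -
  let ?P = "\<lambda>w. w \<in> W \<and> (\<forall>u\<in>W. tinner n u (csub v w) = 0)"
  have "\<exists>w. ?P w"
    using orthogonal_projection_exists[OF finite_strings assms(1), of n v] assms(2)
    unfolding tinner_eq_inner_on by (auto simp: tensor_space_def strings_def subset_iff)
  moreover have "w = w'" if "?P w" "?P w'" for w w'
  proof -
    define d where "d = csub w w'"
    have d: "d \<in> W" using that assms(1) by (simp add: d_def lin_subspace_csub)
    have "inner_on (strings n) d d = tinner n d (csub v w') - tinner n d (csub v w)"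
      unfolding tinner_eq_inner_on by (subst (2) d_def) (simp add: inner_on_csub_right)
    then have "inner_on (strings n) d d = 0" using that d by simp
    then have "d s = 0" for s
      using inner_on_self_eq_0[OF finite_strings] d assms(2)
      by (cases "length s = n") (auto simp: strings_def tensor_space_def subset_iff)
    then show ?thesis by (simp add: d_def csub_def fun_eq_iff)
  qed
  ultimately have "\<exists>!w. ?P w" by blast
  from theI'[OF this]
  show "oproj n W v \<in> W" "\<And>u. u \<in> W \<Longrightarrow> tinner n u (csub v (oproj n W v)) = 0"
    unfolding oproj_def by blast+
qed

section \<open>Completeness\<close>

text \<open>Interchanging the sums over \<open>T\<close> and \<open>Y\<close> replaces the embedding
  by its adjoint, the summation over \<open>m\<close>-sets above \<open>T\<close>. Polytabloids are
  real, so the conjugation disappears.\<close>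

lemma tinner_embed_polytabloid:
  assumes "valid_tableau n x a b"
  shows "tinner n (embed n m (polytabloid x a b)) w =
     mixed_diff a b x {} (\<lambda>T. \<Sum>Y\<in>{Y\<in>Pow {0..<n}. card Y = m}. if T \<subseteq> Y then w (bits n Y) else 0)"
proof -
  let ?E = "polytabloid x a b" and ?P = "{Y\<in>Pow {0..<n}. card Y = m}"
  have cnj: "cnj (?E T) = ?E T" for T
    unfolding polytabloid_def cnj_sum by (intro sum.cong) auto
  have "mixed_diff a b x {} (\<lambda>T. \<Sum>Y\<in>?P. if T \<subseteq> Y then w (bits n Y) else 0) =
    (\<Sum>T\<in>Pow {0..<n}. \<Sum>Y\<in>?P. if T \<subseteq> Y then ?E T * w (bits n Y) else 0)"
    unfolding sum_polytabloid_eq_mixed_diff[OF assms, symmetric] sum_distrib_left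
    by (intro sum.cong) auto
  also have "\<dots> = (\<Sum>Y\<in>?P. \<Sum>T\<in>Pow {0..<n}. if T \<subseteq> Y then ?E T * w (bits n Y) else 0)"
    by (rule sum.swap)
  also have "\<dots> = (\<Sum>Y\<in>?P. \<Sum>T\<in>Pow Y. ?E T * w (bits n Y))"
    by (intro sum.cong refl sum.mono_neutral_cong_right) auto
  also have "\<dots> = (\<Sum>Y\<in>Pow {0..<n}. cnj (embed n m ?E (bits n Y)) * w (bits n Y))"
    by (rule sum.mono_neutral_cong_left)
      (auto simp: embed_def ones_bits cnj sum_distrib_right)
  finally show ?thesis by (simp add: tinner_eq_sum_sets)
qed

text \<open>Let \<open>h T\<close> sum \<open>w\<close> over the \<open>m\<close>-sets above
  \<open>T\<close>. By induction on the size, \<open>h\<close> vanishes on all sets of size at most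
  \<open>m\<close>: vanishing one level below makes \<open>h\<close> harmonic by \<open>up\<close>,
  and orthogonality of \<open>w\<close> to the embedded polytabloids kills its mixed differences. At
  size \<open>m\<close> only \<open>Y\<close> itself lies above \<open>Y\<close>, so
  \<open>h Y\<close> is the coefficient of \<open>w\<close>.\<close>

lemma orthogonal_isotypic_eq_0:
  assumes m: "2 * m \<le> n" and w: "\<And>x u. x \<le> m \<Longrightarrow> u \<in> isotypic n x \<Longrightarrow> tinner n u w = 0"
    and Y: "Y \<subseteq> {0..<n}" "card Y = m"
  shows "w (bits n Y) = 0"
proof -
  define P where "P = {Y\<in>Pow {0..<n}. card Y = m}"
  define h where "h = (\<lambda>T. \<Sum>Y\<in>P. if T \<subseteq> Y then w (bits n Y) else 0)"
  have fin: "finite P" by (simp add: P_def)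
  have up: "(\<Sum>e\<in>{0..<n} - U. h (insert e U)) = of_nat (m - card U) * h U"
    if U: "U \<subseteq> {0..<n}" for U
  proof -
    have "(\<Sum>e\<in>{0..<n} - U. h (insert e U)) =
        (\<Sum>Y\<in>P. \<Sum>e\<in>{0..<n} - U. if insert e U \<subseteq> Y then w (bits n Y) else 0)"
      unfolding h_def by (rule sum.swap)
    \<comment> \<open>Double counting: an \<open>m\<close>-set above \<open>U\<close> contains
      \<open>m - card U\<close> of the possible new elements.\<close>
    also have "\<dots> = (\<Sum>Y\<in>P. of_nat (m - card U) * (if U \<subseteq> Y then w (bits n Y) else 0))"
    proof (rule sum.cong[OF refl])
      fix Y assume Y: "Y \<in> P"
      show "(\<Sum>e\<in>{0..<n} - U. if insert e U \<subseteq> Y then w (bits n Y) else 0) =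
          of_nat (m - card U) * (if U \<subseteq> Y then w (bits n Y) else 0)"
      proof (cases "U \<subseteq> Y")
        case True
        have "finite U" using U finite_subset by blast
        then have card: "card (Y - U) = m - card U"
          using True Y by (simp add: card_Diff_subset P_def)
        have "(\<Sum>e\<in>{0..<n} - U. if insert e U \<subseteq> Y then w (bits n Y) else 0) =
            (\<Sum>e\<in>Y - U. w (bits n Y))"
          using Y True by (intro sum.mono_neutral_cong_right) (auto simp: P_def)
        then show ?thesis using True card by simp
      qed simp
    qed
    finally show ?thesis by (simp add: h_def sum_distrib_left)
  qed
  have eq0: "h T = 0"
    if "harmonic n x h" "x \<le> m" "T \<subseteq> {0..<n}" "card T = x" for x T
  proof (rule harmonic_eq_0[OF that(1) _ that(3,4)])
    fix a b assume v: "valid_tableau n x a b"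
    have "embed n m (polytabloid x a b) \<in> isotypic n x"
      using embed_specht_subset_isotypic[of x m n] polytabloid_in_specht[OF v] that(2) m by auto
    then show "mixed_diff a b x {} h = 0"
      using w[OF that(2)] tinner_embed_polytabloid[OF v, of m w] by (simp add: h_def P_def)
  qed
  have h0: "h T = 0" if "x \<le> m" "T \<subseteq> {0..<n}" "card T = x" for T x
    using that
  proof (induction x arbitrary: T)
    case 0
    then show ?case by (intro eq0[of 0]) (auto simp: harmonic_def)
  next
    case (Suc x)
    have "harmonic n (Suc x) h"
      using Suc.IH Suc.prems(1) by (simp add: harmonic_def up)
    then show ?case using Suc.prems by (intro eq0[of "Suc x"])
  qed
  have "h Y = (\<Sum>Z\<in>{Y}. w (bits n Z))"
    unfolding h_def
  proof (rule sum.mono_neutral_cong_right)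
    show "\<forall>Z\<in>P - {Y}. (if Y \<subseteq> Z then w (bits n Z) else 0) = 0"
    proof
      fix Z assume "Z \<in> P - {Y}"
      then have "\<not> Y \<subseteq> Z"
        using Y card_subset_eq[of Z Y] finite_subset[of Z "{0..<n}"] by (auto simp: P_def)
      then show "(if Y \<subseteq> Z then w (bits n Z) else 0) = 0" by simp
    qed
  qed (use Y fin in \<open>auto simp: P_def\<close>)
  then show ?thesis using h0[of m Y] Y by simp
qed

text \<open>The remainder \<open>w\<close> is orthogonal to all components with
  \<open>x \<le> m\<close>, hence zero on basis vectors of weight \<open>m\<close>. The projections
  are not known to have weight \<open>m\<close>, so the other weights need a second argument:
  \<open>v\<close> lives in weight \<open>m\<close> and is therefore orthogonal to \<open>w\<close>,
  as are the projections, so \<open>w\<close> is orthogonal to itself.\<close>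

lemma isotypic_decomposition:
  assumes v: "v \<in> tensor_space n" "\<And>s. v s \<noteq> 0 \<Longrightarrow> card (ones s) = m" and m: "2 * m \<le> n"
  shows "v = (\<lambda>s. \<Sum>x\<le>m. oproj n (isotypic n x) v s)"
proof -
  define p where "p = (\<lambda>x. oproj n (isotypic n x) v)"
  have p: "p x \<in> isotypic n x" "\<And>u. u \<in> isotypic n x \<Longrightarrow> tinner n u (csub v (p x)) = 0" for x
    unfolding p_def
    by (rule oproj_properties[OF lin_subspace_isotypic isotypic_subset_tensor_space], assumption?)+
  define w where "w = csub v (\<lambda>s. \<Sum>x\<le>m. p x s)"
  have w: "tinner n u w = 0" if "x \<le> m" "u \<in> isotypic n x" for x u
  proof -
    have "tinner n u (p y) = 0" if "y \<in> {..m} - {x}" for y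
      using that \<open>x \<le> m\<close> \<open>u \<in> isotypic n x\<close> m p(1)[of y]
      by (intro isotypic_orthogonal[of x n y]) auto
    then have "(\<Sum>y\<le>m. tinner n u (p y)) = tinner n u (p x)"
      using that(1) by (subst sum.remove[of _ x]) auto
    then show ?thesis
      using p(2)[OF that(2)]
      by (simp add: w_def tinner_eq_inner_on inner_on_csub_right inner_on_sum_right)
  qed
  have "tinner n v w = 0"
    unfolding tinner_eq_sum_sets
  proof (intro sum.neutral ballI)
    fix Y assume "Y \<in> Pow {0..<n}"
    then show "cnj (v (bits n Y)) * w (bits n Y) = 0"
      using orthogonal_isotypic_eq_0[OF m, of w Y] w v(2)[of "bits n Y"] by (auto simp: ones_bits)
  qed
  moreover have "(\<Sum>x\<le>m. tinner n (p x) w) = 0"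
    using w p(1) by (intro sum.neutral) auto
  ultimately have "inner_on (strings n) w w = 0"
    unfolding tinner_eq_inner_on
    by (subst (1) w_def) (simp add: inner_on_csub_left inner_on_sum_left)
  then have "w s = 0" if "length s = n" for s
    using inner_on_self_eq_0[OF finite_strings] that by (simp add: strings_def)
  moreover have "w s = 0" if "length s \<noteq> n" for s
    using that v(1) p(1) isotypic_subset_tensor_space[of n]
    by (fastforce simp: w_def csub_def tensor_space_def intro!: sum.neutral)
  ultimately show ?thesis
    by (auto simp: w_def csub_def p_def fun_eq_iff)
qed

text \<open>The spectral distribution of \<open>v\<close>: \<open>q x\<close> is the squared norm of
  its component. Pythagoras for combinations of the components with real weights,
  \<open>comb\<close>, gives the total mass for weight 1 and the mean squared deviation for the
  weight "eigenvalue minus \<open>c\<close>".\<close>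

lemma isotypic_distribution:
  assumes v: "v \<in> tensor_space n" "\<And>s. v s \<noteq> 0 \<Longrightarrow> card (ones s) = m" and m: "2 * m \<le> n"
  obtains q :: "nat \<Rightarrow> real" where
    "\<And>x. x \<le> m \<Longrightarrow> 0 \<le> q x"
    "\<And>x. x \<le> m \<Longrightarrow> tinner n v (oproj n (isotypic n x) v) = of_real (q x)"
    "tinner n v v = of_real (\<Sum>x\<le>m. q x)"
    "\<And>c :: real. (let d = csub (transposition_sum n v) (cscale (of_real c) v) in tinner n d d) =
       of_real (\<Sum>x\<le>m. (transposition_eigenvalue n x - c)\<^sup>2 * q x)"
proof -
  define p where "p = (\<lambda>x. oproj n (isotypic n x) v)"
  have p: "p x \<in> isotypic n x" for x
    unfolding p_def by (rule oproj_properties[OF lin_subspace_isotypic isotypic_subset_tensor_space])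
  have v_eq: "v = (\<lambda>s. \<Sum>x\<le>m. p x s)"
    unfolding p_def by (rule isotypic_decomposition[OF assms])
  define q where "q = (\<lambda>x. \<Sum>s\<in>strings n. (cmod (p x s))\<^sup>2)"
  have ortho: "tinner n (p x) (p y) = (if x = y then of_real (q x) else 0)" if "x \<le> m" "y \<le> m" for x y
    using that m p isotypic_orthogonal[of x n y "p x" "p y"]
    by (auto simp: tinner_eq_inner_on inner_on_self q_def)
  have comb: "tinner n (\<lambda>s. \<Sum>x\<le>m. of_real (r x) * p x s) (\<lambda>s. \<Sum>x\<le>m. of_real (r x) * p x s) =
      of_real (\<Sum>x\<le>m. (r x)\<^sup>2 * q x)" for r :: "nat \<Rightarrow> real"
  proof -
    have "tinner n (\<lambda>s. \<Sum>x\<le>m. cscale (of_real (r x)) (p x) s) (\<lambda>s. \<Sum>x\<le>m. cscale (of_real (r x)) (p x) s) =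
        (\<Sum>x\<le>m. \<Sum>y\<le>m. of_real (r x) * (of_real (r y) * tinner n (p x) (p y)))"
      by (simp add: tinner_eq_inner_on inner_on_sum_left inner_on_sum_right inner_on_linear
          sum_distrib_left mult.left_commute)
    also have "\<dots> = (\<Sum>x\<le>m. \<Sum>y\<le>m. if x = y then of_real ((r x)\<^sup>2 * q x) else 0)"
      by (intro sum.cong refl) (auto simp: ortho power2_eq_square)
    finally show ?thesis by (simp add: cscale_def)
  qed
  show thesis
  proof (rule that[of q])
    show "0 \<le> q x" for x by (simp add: q_def sum_nonneg)
    show "tinner n v (oproj n (isotypic n x) v) = of_real (q x)" if "x \<le> m" for x
    proof -
      have "tinner n v (p x) = (\<Sum>y\<le>m. tinner n (p y) (p x))"
        by (subst v_eq) (simp add: tinner_eq_inner_on inner_on_sum_left)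
      also have "\<dots> = (\<Sum>y\<le>m. if y = x then of_real (q x) else 0)"
        using that by (intro sum.cong refl) (auto simp: ortho)
      finally show ?thesis using that by (simp add: p_def)
    qed
    show "tinner n v v = of_real (\<Sum>x\<le>m. q x)"
      using comb[of "\<lambda>_. 1"] v_eq by simp
    fix c :: real
    have "transposition_sum n v s = (\<Sum>x\<le>m. of_real (transposition_eigenvalue n x) * p x s)" for s
      by (subst v_eq)
        (simp add: transposition_sum_linear transposition_sum_isotypic[OF p] cscale_def)
    moreover have "of_real c * v s = (\<Sum>x\<le>m. of_real c * p x s)" for s
      by (subst v_eq) (simp add: sum_distrib_left)
    ultimately have "csub (transposition_sum n v) (cscale (of_real c) v) =
       (\<lambda>s. \<Sum>x\<le>m. of_real (transposition_eigenvalue n x - c) * p x s)"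
      by (simp add: csub_def cscale_def sum_subtractf left_diff_distrib)
    then show "(let d = csub (transposition_sum n v) (cscale (of_real c) v) in tinner n d d) =
       of_real (\<Sum>x\<le>m. (transposition_eigenvalue n x - c)\<^sup>2 * q x)"
      unfolding Let_def by (simp only: comb)
  qed
qed

section \<open>The moment estimate\<close>

text \<open>The support of the state for \<open>n = 2m\<close> and \<open>k = 2l\<close>, as sets of
  positions carrying a one: \<open>l\<close> ones, \<open>l\<close> zeros, then a free block of
  length \<open>2(m-l)\<close> holding \<open>m - l\<close> ones.\<close>

definition block_sets :: "nat \<Rightarrow> nat \<Rightarrow> nat set set" where
  "block_sets m l =
     {Y \<in> Pow {0..<2*m}. card Y = m \<and> {0..<l} \<subseteq> Y \<and> Y \<inter> {l..<2*l} = {}}"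

lemma block_setsD:
  assumes "Y \<in> block_sets m l" "l \<le> m"
  shows "Y \<subseteq> {0..<2*m}" "card Y = m" "Y = {0..<l} \<union> (Y \<inter> {2*l..<2*m})"
    "card (Y \<inter> {2*l..<2*m}) = m - l"
proof -
  show Y: "Y \<subseteq> {0..<2*m}" "card Y = m" using assms by (auto simp: block_sets_def)
  show eq: "Y = {0..<l} \<union> (Y \<inter> {2*l..<2*m})"
  proof -
    have "i \<in> {0..<l} \<union> {2*l..<2*m}" if "i \<in> Y" for i
      using that assms by (cases "i < l"; cases "i < 2 * l") (auto simp: block_sets_def)
    moreover have "{0..<l} \<subseteq> Y" using assms by (simp add: block_sets_def)
    ultimately show ?thesis by blast
  qed
  have "card Y = card {0..<l} + card (Y \<inter> {2*l..<2*m})"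
    by (subst eq, rule card_Un_disjoint) auto
  then show "card (Y \<inter> {2*l..<2*m}) = m - l" using Y by simp
qed

lemma card_block_sets:
  assumes "l \<le> m"
  shows "card (block_sets m l) = (2 * (m - l)) choose (m - l)"
proof -
  have "bij_betw (\<lambda>Y. Y \<inter> {2*l..<2*m}) (block_sets m l) {A. A \<subseteq> {2*l..<2*m} \<and> card A = m - l}"
  proof (rule bij_betw_byWitness[where f' = "\<lambda>A. {0..<l} \<union> A"])
    show "\<forall>Y\<in>block_sets m l. {0..<l} \<union> (Y \<inter> {2*l..<2*m}) = Y"
      using block_setsD(3)[OF _ assms] by blast
    show "\<forall>A\<in>{A. A \<subseteq> {2*l..<2*m} \<and> card A = m - l}. ({0..<l} \<union> A) \<inter> {2*l..<2*m} = A"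
      by auto
    show "(\<lambda>Y. Y \<inter> {2*l..<2*m}) ` block_sets m l \<subseteq> {A. A \<subseteq> {2*l..<2*m} \<and> card A = m - l}"
      using block_setsD(4)[OF _ assms] by auto
    have "{0..<l} \<union> A \<in> block_sets m l" if A: "A \<subseteq> {2*l..<2*m}" "card A = m - l" for A
    proof -
      have "card ({0..<l} \<union> A) = card {0..<l} + card A"
        using A finite_subset[of A] by (intro card_Un_disjoint) auto
      moreover have "({0..<l} \<union> A) \<inter> {l..<2*l} = {}" using A by fastforce
      ultimately show ?thesis using A assms by (auto simp: block_sets_def)
    qed
    then show "(\<lambda>A. {0..<l} \<union> A) ` {A. A \<subseteq> {2*l..<2*m} \<and> card A = m - l} \<subseteq> block_sets m l"
      by auto
  qed
  then show ?thesis
    by (simp add: bij_betw_same_card n_subsets diff_mult_distrib2)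
qed

lemma Xi_bits:
  assumes "l \<le> m" "Y \<subseteq> {0..<2*m}"
  shows "Xi (2*m) m (2*l) l (bits (2*m) Y) =
    (if Y \<in> block_sets m l then of_real (1 / sqrt (real (card (block_sets m l)))) else 0)"
proof -
  let ?s = "bits (2*m) Y"
  have t1: "take l ?s = replicate l True \<longleftrightarrow> {0..<l} \<subseteq> Y"
    using assms(1) by (auto simp: list_eq_iff_nth_eq bits_def)
  have "take l (drop l ?s) = replicate l False \<longleftrightarrow> (\<forall>i<l. l + i \<notin> Y)"
    using assms(1) by (auto simp: list_eq_iff_nth_eq bits_def)
  also have "\<dots> \<longleftrightarrow> Y \<inter> {l..<2*l} = {}"
  proof
    assume *: "\<forall>i<l. l + i \<notin> Y"
    have "i \<notin> Y" if i: "i \<in> {l..<2*l}" for i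
    proof -
      obtain k where "i = l + k" using i le_Suc_ex[of l i] by auto
      then show ?thesis using * i by auto
    qed
    then show "Y \<inter> {l..<2*l} = {}" by blast
  next
    assume "Y \<inter> {l..<2*l} = {}"
    moreover have "l + i \<in> {l..<2*l}" if "i < l" for i using that by simp
    ultimately show "\<forall>i<l. l + i \<notin> Y" by blast
  qed
  finally have t2: "take l (drop l ?s) = replicate l False \<longleftrightarrow> Y \<inter> {l..<2*l} = {}" .
  have "length (filter id (drop (2*l) ?s)) = length (filter (\<lambda>i. i \<in> Y) [2*l..<2*m])"
    by (simp add: bits_def drop_map filter_map o_def)
  also have "\<dots> = card (Y \<inter> {2*l..<2*m})"
    by (subst distinct_card[symmetric]) (auto intro!: arg_cong[where f = card])
  finally have t3: "length (filter id (drop (2*l) ?s)) = card (Y \<inter> {2*l..<2*m})" .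
  have "card (Y \<inter> {2*l..<2*m}) = m - l \<longleftrightarrow> card Y = m"
    if Y: "{0..<l} \<subseteq> Y" "Y \<inter> {l..<2*l} = {}"
  proof -
    have "i \<in> {0..<l} \<union> {2*l..<2*m}" if "i \<in> Y" for i
      using that Y(2) assms(2) by (cases "i < l"; cases "i < 2 * l") auto
    then have "Y = {0..<l} \<union> (Y \<inter> {2*l..<2*m})" using Y by blast
    moreover have "card ({0..<l} \<union> (Y \<inter> {2*l..<2*m})) = card {0..<l} + card (Y \<inter> {2*l..<2*m})"
      by (rule card_Un_disjoint) auto
    ultimately show ?thesis using assms(1) by auto
  qed
  then have cond: "({0..<l} \<subseteq> Y \<and> Y \<inter> {l..<2*l} = {} \<and> card (Y \<inter> {2*l..<2*m}) = m - l) \<longleftrightarrow>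
      Y \<in> block_sets m l"
    using assms(2) by (auto simp: block_sets_def)
  \<comment> \<open>Both M and N equal \<open>m - l\<close> here, so the normalising binomial is the
    size of the support.\<close>
  have "m - l + (2*m + l - (m + 2*l)) = 2 * (m - l)" using assms(1) by simp
  then have N: "real ((m - l + (2*m + l - (m + 2*l))) choose (m - l)) = real (card (block_sets m l))"
    unfolding card_block_sets[OF assms(1)] by (rule arg_cong)
  have "2 * l - l = l" by simp
  then have "length ?s = 2*m \<and> take l ?s = replicate l True
      \<and> take (2*l - l) (drop l ?s) = replicate (2*l - l) False
      \<and> length (filter id (drop (2*l) ?s)) = m - l \<longleftrightarrow> Y \<in> block_sets m l"
    unfolding cond[symmetric] t1 t2[symmetric] t3 by simp
  then show ?thesis
    unfolding Xi_def N by (rule if_cong) (rule refl)+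
qed

text \<open>Its cardinality is, up to the normalisation of the state, the coefficient at
  \<open>Y\<close> of \<open>transposition_sum\<close> applied to the state.\<close>

definition block_swaps :: "nat \<Rightarrow> nat \<Rightarrow> nat set \<Rightarrow> (nat \<times> nat) set" where
  "block_swaps m l Y =
     {(i, j). i < 2*m \<and> j < 2*m \<and> transpose i j -` Y \<in> block_sets m l}"

lemma card_vimage_transpose: "card (transpose i j -` Y) = card Y"
  by (intro card_vimage_inj) auto

text \<open>Swaps of equal bits fix \<open>Y\<close>; swaps of different bits stay in the support
  exactly when both positions lie in the free block. The count is the same for every
  \<open>Y\<close> in the support, so the state is reproduced there with a constant factor.\<close>

lemma card_block_swaps_eq:
  assumes l: "l \<le> m" and Y: "Y \<in> block_sets m l"
  shows "card (block_swaps m l Y) = 2 * m\<^sup>2 + 2 * (m - l)\<^sup>2"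
proof -
  define C where "C = {0..<2*m} - Y"
  define Y3 where "Y3 = Y \<inter> {2*l..<2*m}"
  define C3 where "C3 = {2*l..<2*m} - Y"
  note D = block_setsD[OF Y l]
  have fin: "finite Y" "finite C" "finite Y3" "finite C3"
    using D(1) finite_subset by (auto simp: C_def Y3_def C3_def)
  have "card C = m" using D fin by (simp add: C_def card_Diff_subset)
  moreover have "C3 = {2*l..<2*m} - Y3" by (auto simp: C3_def Y3_def)
  then have "card C3 = m - l"
    using D(4) fin by (simp add: card_Diff_subset Y3_def)
  ultimately have cards: "card Y = m" "card C = m" "card Y3 = m - l" "card C3 = m - l"
    using D by (auto simp: Y3_def)
  have mem: "transpose i j -` Y \<in> block_sets m l \<longleftrightarrow> (i \<in> Y \<longleftrightarrow> j \<in> Y) \<or> (2*l \<le> i \<and> 2*l \<le> j)"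
    if ij: "i < 2*m" "j < 2*m" for i j
  proof (cases "i \<in> Y \<longleftrightarrow> j \<in> Y")
    case True
    then have "transpose i j -` Y = Y" by (auto simp: transpose_def split: if_splits)
    then show ?thesis using Y True by simp
  next
    case False
    have vim: "k \<in> transpose i j -` Y \<longleftrightarrow> (if k = i then j \<in> Y else if k = j then i \<in> Y else k \<in> Y)" for k
      by (auto simp: transpose_def)
    have sub: "transpose i j -` Y \<subseteq> {0..<2*m}"
      using D(1) ij by (auto simp: transpose_def split: if_splits)
    have Yk: "k \<in> Y" if "k < l" for k using Y that by (auto simp: block_sets_def)
    have Yk': "k \<notin> Y" if "l \<le> k" "k < 2*l" for k using Y that by (auto simp: block_sets_def)
    show ?thesis
    proof (cases "2*l \<le> i \<and> 2*l \<le> j")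
      case True
      have "{0..<l} \<subseteq> transpose i j -` Y" using True Yk by (auto simp: vim)
      moreover have "transpose i j -` Y \<inter> {l..<2*l} = {}" using True Yk' by (auto simp: vim)
      ultimately show ?thesis
        using sub D(2) True by (simp add: block_sets_def card_vimage_transpose)
    next
      case bad: False
      \<comment> \<open>A swap of different bits that touches a position of the first two blocks
        flips the bit prescribed there.\<close>
      then obtain k where k: "k < 2*l" "k = i \<or> k = j"
        by (metis linorder_not_le)
      have ne: "k \<in> transpose i j -` Y \<longleftrightarrow> k \<notin> Y" using k False by (auto simp: vim)
      have "transpose i j -` Y \<notin> block_sets m l"
      proof
        assume T: "transpose i j -` Y \<in> block_sets m l"
        show False
        proof (cases "k < l")
          case True
          then have "k \<in> transpose i j -` Y" using T by (auto simp: block_sets_def)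
          then show False using ne Yk[OF True] by simp
        next
          case False
          then have "k \<notin> transpose i j -` Y" using T k(1) by (auto simp: block_sets_def)
          then show False using ne Yk'[of k] False k(1) by simp
        qed
      qed
      then show ?thesis using False bad by simp
    qed
  qed
  have "block_swaps m l Y = ((Y \<times> Y) \<union> (C \<times> C)) \<union> ((Y3 \<times> C3) \<union> (C3 \<times> Y3))"
  proof (intro set_eqI)
    fix p :: "nat \<times> nat"
    obtain i j where p: "p = (i, j)" by (cases p)
    have lt: "k < 2*m" if "k \<in> Y" for k using D(1) that by auto
    have "p \<in> block_swaps m l Y \<longleftrightarrow>
        i < 2*m \<and> j < 2*m \<and> ((i \<in> Y \<longleftrightarrow> j \<in> Y) \<or> (2*l \<le> i \<and> 2*l \<le> j))"
      using mem[of i j] by (auto simp: block_swaps_def p)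
    also have "\<dots> \<longleftrightarrow> p \<in> ((Y \<times> Y) \<union> (C \<times> C)) \<union> ((Y3 \<times> C3) \<union> (C3 \<times> Y3))"
      using lt by (auto simp: C_def Y3_def C3_def p)
    finally show "p \<in> block_swaps m l Y \<longleftrightarrow>
        p \<in> ((Y \<times> Y) \<union> (C \<times> C)) \<union> ((Y3 \<times> C3) \<union> (C3 \<times> Y3))" .
  qed
  moreover have "card (((Y \<times> Y) \<union> (C \<times> C)) \<union> ((Y3 \<times> C3) \<union> (C3 \<times> Y3))) =
      card (Y \<times> Y) + card (C \<times> C) + (card (Y3 \<times> C3) + card (C3 \<times> Y3))"
    using fin by (subst card_Un_disjoint; (subst card_Un_disjoint)?; (subst card_Un_disjoint)?)
      (auto simp: C_def Y3_def C3_def)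
  ultimately show ?thesis
    by (simp add: card_cartesian_product cards power2_eq_square)
qed

text \<open>Off the support of the state, some position in the first two blocks carries the wrong
  bit, and a transposition leading back into the support has to move this position.\<close>

lemma card_block_swaps_le:
  assumes Y: "Y \<subseteq> {0..<2*m}" "Y \<notin> block_sets m l"
  shows "card (block_swaps m l Y) \<le> 4 * m"
proof (cases "card Y = m")
  case False
  then have "block_swaps m l Y = {}"
    by (auto simp: block_swaps_def block_sets_def card_vimage_transpose)
  then show ?thesis by simp
next
  case True
  then have "\<not> {0..<l} \<subseteq> Y \<or> Y \<inter> {l..<2*l} \<noteq> {}"
    using Y by (simp add: block_sets_def)
  then obtain r where r: "(r < l \<and> r \<notin> Y) \<or> (l \<le> r \<and> r < 2*l \<and> r \<in> Y)"
    by fastforce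
  have "block_swaps m l Y \<subseteq> {r} \<times> {0..<2*m} \<union> {0..<2*m} \<times> {r}"
  proof
    fix p assume p: "p \<in> block_swaps m l Y"
    obtain i j where ij: "p = (i, j)" by (cases p)
    have "i = r \<or> j = r"
    proof (rule ccontr)
      assume "\<not> ?thesis"
      then have "r \<in> transpose i j -` Y \<longleftrightarrow> r \<in> Y" by (auto simp: transpose_def)
      moreover have "transpose i j -` Y \<in> block_sets m l" using p ij by (simp add: block_swaps_def)
      ultimately show False using r by (auto simp: block_sets_def)
    qed
    then show "p \<in> {r} \<times> {0..<2*m} \<union> {0..<2*m} \<times> {r}"
      using p ij by (auto simp: block_swaps_def)
  qed
  then have "card (block_swaps m l Y) \<le> card ({r} \<times> {0..<2*m} \<union> {0..<2*m} \<times> {r})"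
    by (intro card_mono) auto
  also have "\<dots> \<le> card ({r} \<times> {0..<2*m}) + card ({0..<2*m} \<times> {r})"
    by (rule card_Un_le)
  also have "\<dots> = 4 * m" by (simp add: card_cartesian_product)
  finally show ?thesis .
qed

lemma card_block_swaps_eq_sum:
  "card (block_swaps m l Y) =
    (\<Sum>i\<in>{0..<2*m}. \<Sum>j\<in>{0..<2*m}. if transpose i j -` Y \<in> block_sets m l then 1 else 0)"
proof -
  have "(\<Sum>p\<in>{0..<2*m} \<times> {0..<2*m}.
      if transpose (fst p) (snd p) -` Y \<in> block_sets m l then 1 else 0) = card (block_swaps m l Y)"
    by (subst sum.inter_filter[symmetric])
      (auto simp: block_swaps_def intro!: arg_cong[where f = card])
  then show ?thesis by (simp add: sum.cartesian_product case_prod_unfold)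
qed

text \<open>Each transposition permutes the subsets of positions, so each of the
  \<open>(2m)^2\<close> ordered pairs contributes the size of the support once. This total is
  combined with the pointwise bound off the support.\<close>

lemma sum_card_block_swaps:
  "(\<Sum>Y\<in>Pow {0..<2*m}. card (block_swaps m l Y)) = (2*m)\<^sup>2 * card (block_sets m l)"
proof -
  have "(\<Sum>Y\<in>Pow {0..<2*m}. if transpose i j -` Y \<in> block_sets m l then 1 else 0) =
      card (block_sets m l)" if ij: "i \<in> {0..<2*m}" "j \<in> {0..<2*m}" for i j
  proof -
    note p = transpose_permutes_lessThan[OF ij]
    have sub: "transpose i j -` Y \<subseteq> {0..<2*m}" if "Y \<subseteq> {0..<2*m}" for Y
      using vimage_mono[OF that, of "transpose i j"] permutes_vimage[OF p] by simp
    have inv: "transpose i j -` transpose i j -` Y = Y" for Y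
      by (simp add: vimage_def)
    have "(\<Sum>Y\<in>Pow {0..<2*m}. if transpose i j -` Y \<in> block_sets m l then 1 else 0) =
        (\<Sum>Y\<in>Pow {0..<2*m}. if Y \<in> block_sets m l then 1 else 0 :: nat)"
      by (rule sum.reindex_bij_witness[of _ "vimage (transpose i j)" "vimage (transpose i j)"])
        (use sub in \<open>auto simp: inv\<close>)
    also have "\<dots> = card (block_sets m l)"
      by (subst sum.inter_filter[symmetric]) (auto simp: block_sets_def intro!: arg_cong[where f = card])
    finally show ?thesis .
  qed
  then show ?thesis
    unfolding card_block_swaps_eq_sum
    by (simp add: sum.swap[of _ _ "Pow {0..<2*m}"] power2_eq_square)
qed

section \<open>From the swap counts to the moments of the distribution\<close>

lemma isotypic_distribution_Xi:
  assumes l: "l \<le> m"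
  obtains q :: "nat \<Rightarrow> real" where
    "\<And>x. x \<le> m \<Longrightarrow> 0 \<le> q x"
    "\<And>x. x \<le> m \<Longrightarrow> pdist x (2*m) m (2*l) l = of_real (q x)"
    "(\<Sum>x\<le>m. q x) = 1"
    "(\<Sum>x\<le>m. (transposition_eigenvalue (2*m) x - (2 * (real m)\<^sup>2 + 2 * (real m - real l)\<^sup>2))\<^sup>2 * q x)
       \<le> 2 * (2 * real m) ^ 3"
proof -
  define n where "n = 2 * m"
  define v where "v = Xi n m (2*l) l"
  define B where "B = block_sets m l"
  define K where "K = 1 / sqrt (real (card B))"
  define cnt where "cnt = (\<lambda>Y. card (block_swaps m l Y))"
  define c where "c = 2 * (real m)\<^sup>2 + 2 * (real m - real l)\<^sup>2"
  have "0 < card B" unfolding B_def card_block_sets[OF l] by (simp add: zero_less_binomial)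
  then have K2: "K\<^sup>2 * card B = 1"
    by (simp add: K_def power_divide)
  have B: "B \<subseteq> Pow {0..<n}" by (auto simp: B_def block_sets_def n_def)
  have v: "v (bits n Y) = (if Y \<in> B then of_real K else 0)" if "Y \<subseteq> {0..<n}" for Y
    using Xi_bits[OF l, of Y] that by (simp add: v_def B_def K_def n_def)
  have tens: "v \<in> tensor_space n"
    by (simp add: v_def tensor_space_def Xi_def)
  have wt: "card (ones s) = m" if "v s \<noteq> 0" for s
  proof -
    have len: "length s = n" using that tens by (auto simp: tensor_space_def)
    then have "ones s \<in> B"
      using v[of "ones s"] ones_subset[of s] that by (auto simp: bits_ones split: if_splits)
    then show ?thesis by (simp add: B_def block_sets_def)
  qed
  have m2: "2 * m \<le> n" by (simp add: n_def)
  obtain q where q: "\<And>x. x \<le> m \<Longrightarrow> 0 \<le> q x"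
    "\<And>x. x \<le> m \<Longrightarrow> tinner n v (oproj n (isotypic n x) v) = of_real (q x)"
    "tinner n v v = of_real (\<Sum>x\<le>m. q x)"
    "\<And>c :: real. (let d = csub (transposition_sum n v) (cscale (of_real c) v) in tinner n d d) =
       of_real (\<Sum>x\<le>m. (transposition_eigenvalue n x - c)\<^sup>2 * q x)"
    using isotypic_distribution[OF tens wt m2] by blast
  have "tinner n v v = (\<Sum>Y\<in>Pow {0..<n}. if Y \<in> B then of_real (K\<^sup>2) else 0)"
    unfolding tinner_eq_sum_sets by (intro sum.cong refl) (auto simp: v power2_eq_square)
  also have "\<dots> = of_real (K\<^sup>2 * card B)"
    using B by (simp add: sum.If_cases Int_absorb1 Collect_mem_eq)
  finally have "(\<Sum>x\<le>m. q x) = 1"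
    unfolding q(3) K2 by (simp only: of_real_eq_iff)
  moreover have "(\<Sum>x\<le>m. (transposition_eigenvalue n x - c)\<^sup>2 * q x) \<le> 2 * (2 * real m) ^ 3"
  proof -
    define d where "d = csub (transposition_sum n v) (cscale (of_real c) v)"
    have Tv: "transposition_sum n v (bits n Y) = of_real (K * cnt Y)" if Y: "Y \<subseteq> {0..<n}" for Y
    proof -
      have "act_V n (transpose i j) v (bits n Y) =
          of_real K * of_nat (if transpose i j -` Y \<in> B then 1 else 0)"
        if ij: "i \<in> {0..<n}" "j \<in> {0..<n}" for i j
      proof -
        note p = transpose_permutes_lessThan[OF ij]
        have "transpose i j -` Y \<subseteq> {0..<n}"
          using vimage_mono[OF Y, of "transpose i j"] permutes_vimage[OF p] by simp
        then show ?thesis by (simp add: act_V_bits[OF p] v)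
      qed
      then have "transposition_sum n v (bits n Y) = (\<Sum>i\<in>{0..<n}. \<Sum>j\<in>{0..<n}.
          of_real K * of_nat (if transpose i j -` Y \<in> B then 1 else 0))"
        unfolding transposition_sum_def by (intro sum.cong refl)
      then show ?thesis
        unfolding cnt_def card_block_swaps_eq_sum B_def n_def
        by (simp only: sum_distrib_left of_nat_sum of_real_sum of_real_mult of_real_of_nat_eq)
    qed
    have c: "real (cnt Y) = c" if "Y \<in> B" for Y
      using card_block_swaps_eq[OF l, of Y] that l
      by (simp add: cnt_def B_def c_def of_nat_diff)
    have d: "d (bits n Y) = (if Y \<in> B then 0 else of_real (K * cnt Y))" if "Y \<subseteq> {0..<n}" for Y
    proof -
      have "complex_of_nat (cnt Y) = of_real c" if "Y \<in> B"
        using c[OF that] by (metis of_real_of_nat_eq)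
      then show ?thesis using that by (simp add: d_def csub_def cscale_def Tv v)
    qed
    have "tinner n d d = of_real (\<Sum>Y\<in>Pow {0..<n}. if Y \<in> B then 0 else (K * cnt Y)\<^sup>2)"
      unfolding tinner_eq_sum_sets of_real_sum
      by (intro sum.cong refl) (auto simp: d power2_eq_square)
    then have "(\<Sum>x\<le>m. (transposition_eigenvalue n x - c)\<^sup>2 * q x) =
        (\<Sum>Y\<in>Pow {0..<n}. if Y \<in> B then 0 else (K * cnt Y)\<^sup>2)"
      using q(4)[of c] unfolding d_def Let_def by (simp only: of_real_eq_iff)
    \<comment> \<open>One factor \<open>cnt Y\<close> is bounded by \<open>4 * m\<close>, the other
      is kept; adding nonnegative terms on the support then lets the total count be
      inserted.\<close>
    also have "\<dots> \<le> (\<Sum>Y\<in>Pow {0..<n}. K\<^sup>2 * ((4 * real m) * cnt Y))"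
    proof (rule sum_mono)
      fix Y assume Y: "Y \<in> Pow {0..<n}"
      show "(if Y \<in> B then 0 else (K * cnt Y)\<^sup>2) \<le> K\<^sup>2 * ((4 * real m) * cnt Y)"
      proof (cases "Y \<in> B")
        case False
        then have "cnt Y \<le> 4 * m"
          using Y card_block_swaps_le[of Y m l] by (simp add: cnt_def B_def n_def)
        then have "real (cnt Y) * cnt Y \<le> (4 * real m) * cnt Y"
          by (intro mult_right_mono) auto
        then have "K\<^sup>2 * (real (cnt Y) * cnt Y) \<le> K\<^sup>2 * ((4 * real m) * cnt Y)"
          by (intro mult_left_mono) auto
        then show ?thesis using False by (simp add: power2_eq_square algebra_simps)
      qed simp
    qed
    also have "\<dots> = K\<^sup>2 * (4 * real m) * real (\<Sum>Y\<in>Pow {0..<n}. cnt Y)"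
      by (simp add: sum_distrib_left mult.assoc)
    also have "\<dots> = K\<^sup>2 * card B * ((4 * real m) * (2 * real m)\<^sup>2)"
      unfolding cnt_def n_def sum_card_block_swaps B_def by simp
    also have "\<dots> = 2 * (2 * real m) ^ 3"
      unfolding K2 by (simp add: power2_eq_square power3_eq_cube)
    finally show ?thesis .
  qed
  ultimately show thesis
    using q(1,2) by (intro that[of q]) (simp_all add: n_def c_def v_def pdist_def)
qed

text \<open>The mass is concentrated at \<open>l\<close> because
  \<open>(x - l)\<^sup>2 \<le> \<bar>x - l\<bar> (2m - l - x)\<close>, and the right-hand side is, up to \<open>x\<close>, half the
  distance between the eigenvalue at \<open>x\<close> and its approximate mean.\<close>

lemma pow4_le_eigenvalue_deviation:
  assumes "l \<le> m" "x \<le> m"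
  shows "(real x - real l) ^ 4 \<le>
    (transposition_eigenvalue (2*m) x - (2 * (real m)\<^sup>2 + 2 * (real m - real l)\<^sup>2))\<^sup>2 / 2
      + 2 * (real m)\<^sup>2"
proof -
  define D where "D = transposition_eigenvalue (2*m) x - (2 * (real m)\<^sup>2 + 2 * (real m - real l)\<^sup>2)"
  define y where "y = (real x - real l)\<^sup>2"
  \<comment> \<open>The constant is z^2 + (2m-z)^2 at z = l; apart from \<open>- 2 * real x\<close>,
    this is the factored difference of that expression at x and l.\<close>
  have D: "D = 2 * ((real l - real x) * (2 * real m - real l - real x)) - 2 * real x"
    by (simp add: D_def transposition_eigenvalue_def power2_eq_square algebra_simps)
  have "y = \<bar>real l - real x\<bar> * \<bar>real l - real x\<bar>"
    by (simp add: y_def power2_eq_square algebra_simps)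
  also have "\<dots> \<le> \<bar>real l - real x\<bar> * (2 * real m - real l - real x)"
    using assms by (intro mult_left_mono) auto
  also have "\<dots> = \<bar>(real l - real x) * (2 * real m - real l - real x)\<bar>"
    using assms by (simp add: abs_mult)
  also have "(real l - real x) * (2 * real m - real l - real x) = D / 2 + real x"
    using D by linarith
  also have "\<bar>D / 2 + real x\<bar> \<le> \<bar>D\<bar> / 2 + real m" using assms by linarith
  finally have y: "y \<le> \<bar>D\<bar> / 2 + real m" .
  have "0 \<le> y" by (simp add: y_def)
  then have "y\<^sup>2 \<le> (\<bar>D\<bar> / 2 + real m)\<^sup>2" using y by (intro power_mono)
  \<comment> \<open>(a + b)^2 \<le> 2 a^2 + 2 b^2 with a = |D|/2 and b = m.\<close>
  also have "\<dots> \<le> D\<^sup>2 / 2 + 2 * (real m)\<^sup>2"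
    using sum_squares_bound[of "\<bar>D\<bar> / 2" "real m"] by (simp add: power2_sum power_divide)
  finally show ?thesis
    by (simp add: y_def D_def power_mult[symmetric])
qed

text \<open>Instead of Jensen's inequality, the pointwise estimate |d| \<le> t + d^4 / t^3 is
  averaged; it holds because either |d| \<le> t or |d|^3 \<ge> t^3. The free \<open>t\<close> can
  later be taken proportional to n.\<close>

lemma mean_deviation_le:
  assumes l: "l \<le> m" and t: "0 < t"
  shows "cmod ((\<Sum>x\<le>m. of_nat x * pdist x (2*m) m (2*l) l) - of_nat l) \<le> t + 10 * real m ^ 3 / t ^ 3"
proof (cases "m = 0")
  case False
  obtain q where q: "\<And>x. x \<le> m \<Longrightarrow> 0 \<le> q x"
    "\<And>x. x \<le> m \<Longrightarrow> pdist x (2*m) m (2*l) l = of_real (q x)"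
    "(\<Sum>x\<le>m. q x) = 1"
    "(\<Sum>x\<le>m. (transposition_eigenvalue (2*m) x - (2 * (real m)\<^sup>2 + 2 * (real m - real l)\<^sup>2))\<^sup>2 * q x)
       \<le> 2 * (2 * real m) ^ 3"
    using isotypic_distribution_Xi[OF l] by blast
  let ?D = "\<lambda>x. transposition_eigenvalue (2*m) x - (2 * (real m)\<^sup>2 + 2 * (real m - real l)\<^sup>2)"
  have "(\<Sum>x\<le>m. (real x - real l) ^ 4 * q x) \<le> (\<Sum>x\<le>m. ((?D x)\<^sup>2 / 2 + 2 * (real m)\<^sup>2) * q x)"
    using q(1) pow4_le_eigenvalue_deviation[OF l] by (intro sum_mono mult_right_mono) auto
  also have "\<dots> = (\<Sum>x\<le>m. (?D x)\<^sup>2 * q x) / 2 + 2 * (real m)\<^sup>2 * (\<Sum>x\<le>m. q x)"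
    by (simp add: distrib_right sum.distrib sum_distrib_left sum_divide_distrib)
  also have "\<dots> \<le> (2 * real m) ^ 3 + 2 * (real m)\<^sup>2"
    using q(3,4) by simp
  \<comment> \<open>The constant 10 merges 8 m^3 + 2 m^2, using m \<ge> 1.\<close>
  also have "\<dots> \<le> 10 * real m ^ 3"
  proof -
    have "(real m)\<^sup>2 * 1 \<le> (real m)\<^sup>2 * real m" using False by (intro mult_left_mono) auto
    then show ?thesis by (simp add: power2_eq_square power3_eq_cube)
  qed
  finally have m4: "(\<Sum>x\<le>m. (real x - real l) ^ 4 * q x) \<le> 10 * real m ^ 3" .
  have pt: "\<bar>d\<bar> \<le> t + d ^ 4 / t ^ 3" for d :: real
  proof (cases "\<bar>d\<bar> \<le> t")
    case True
    have "0 \<le> d ^ 4 / t ^ 3" using t by simp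
    then show ?thesis using True by linarith
  next
    case False
    then have "t ^ 3 \<le> \<bar>d\<bar> ^ 3" using t by (intro power_mono) auto
    then have "\<bar>d\<bar> * t ^ 3 \<le> \<bar>d\<bar> * \<bar>d\<bar> ^ 3" by (intro mult_left_mono) auto
    also have "\<dots> = \<bar>d\<bar> ^ 4" by (simp add: power_Suc[symmetric] del: power_Suc)
    also have "\<dots> = d ^ 4" by simp
    finally have "\<bar>d\<bar> \<le> d ^ 4 / t ^ 3" using t by (simp add: field_simps)
    then show ?thesis using t by linarith
  qed
  have "(\<Sum>x\<le>m. of_nat x * pdist x (2*m) m (2*l) l) - of_nat l =
      of_real (\<Sum>x\<le>m. real x * q x) - of_real (real l * (\<Sum>x\<le>m. q x))"
    using q(2,3) by simp
  also have "\<dots> = of_real (\<Sum>x\<le>m. (real x - real l) * q x)"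
    unfolding of_real_diff[symmetric] by (simp add: sum_distrib_left sum_subtractf left_diff_distrib)
  finally have "cmod ((\<Sum>x\<le>m. of_nat x * pdist x (2*m) m (2*l) l) - of_nat l) =
      \<bar>\<Sum>x\<le>m. (real x - real l) * q x\<bar>"
    by (simp only: norm_of_real)
  also have "\<dots> \<le> (\<Sum>x\<le>m. \<bar>(real x - real l) * q x\<bar>)"
    by (rule sum_abs)
  also have "\<dots> \<le> (\<Sum>x\<le>m. (t + (real x - real l) ^ 4 / t ^ 3) * q x)"
    using q(1) pt by (intro sum_mono) (auto simp: abs_mult intro!: mult_right_mono)
  also have "\<dots> = t * (\<Sum>x\<le>m. q x) + (\<Sum>x\<le>m. (real x - real l) ^ 4 * q x) / t ^ 3"
    by (simp add: distrib_right sum.distrib sum_distrib_left sum_divide_distrib)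
  also have "\<dots> \<le> t + 10 * real m ^ 3 / t ^ 3"
    using q(3) m4 t by (simp add: divide_right_mono)
  finally show ?thesis .
qed (use l t in auto)

theorem theoremB6:
  fixes \<alpha> :: real
  assumes "0 \<le> \<alpha>" and "\<alpha> \<le> 1/2"
  shows "((\<lambda>n. \<Sum>x\<le>n div 2. (of_nat x / of_nat n) *
              pdist x n (n div 2) (2 * nat \<lfloor>\<alpha> * real n\<rfloor>) (nat \<lfloor>\<alpha> * real n\<rfloor>))
           \<longlongrightarrow> complex_of_real \<alpha>)
          (inf at_top (principal {n. even n \<and> \<alpha> * real n \<in> \<int>}))
       \<and> (let \<beta> = 1/2 - \<alpha>; \<delta> = 1/2 - \<alpha>; \<gamma> = \<alpha>
          in \<alpha> = (1 - sqrt (1 - 4 * (\<alpha> * \<gamma> + \<alpha> * \<delta> + \<beta> * \<gamma>))) / 2)"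
proof
  \<comment> \<open>The discriminant is a perfect square, and \<alpha> \<le> 1/2 selects the root 1
    - 2\<alpha>.\<close>
  have "1 - 4 * (\<alpha> * \<alpha> + \<alpha> * (1/2 - \<alpha>) + (1/2 - \<alpha>) * \<alpha>) = (1 - 2 * \<alpha>)\<^sup>2"
    by (simp add: power2_eq_square field_simps)
  then show "let \<beta> = 1/2 - \<alpha>; \<delta> = 1/2 - \<alpha>; \<gamma> = \<alpha>
          in \<alpha> = (1 - sqrt (1 - 4 * (\<alpha> * \<gamma> + \<alpha> * \<delta> + \<beta> * \<gamma>))) / 2"
    unfolding Let_def using assms(2) by simp
next
  let ?F = "\<lambda>n. \<Sum>x\<le>n div 2. (of_nat x / of_nat n) *
              pdist x n (n div 2) (2 * nat \<lfloor>\<alpha> * real n\<rfloor>) (nat \<lfloor>\<alpha> * real n\<rfloor>)"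
  show "(?F \<longlongrightarrow> complex_of_real \<alpha>) (inf at_top (principal {n. even n \<and> \<alpha> * real n \<in> \<int>}))"
  proof (rule tendstoI)
    fix e :: real assume e: "0 < e"
    \<comment> \<open>With t = e n / 2 and m = n / 2 the deviation bound divided by n is e/2 + 10 /
      (e^3 n), and the second term falls below e/2 exactly when n > 20 / e^4.\<close>
    have bound: "dist (?F n) (complex_of_real \<alpha>) < e"
      if n: "20 / e ^ 4 < real n" "even n" "\<alpha> * real n \<in> \<int>" for n
    proof -
      obtain m where m: "n = 2 * m" using n(2) by (elim evenE)
      define l where "l = nat \<lfloor>\<alpha> * real n\<rfloor>"
      have "0 \<le> 20 / e ^ 4" using e by simp
      then have npos: "0 < real n" using n(1) by linarith
      have "0 \<le> \<alpha> * real n" using assms by simp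
      \<comment> \<open>Integrality of \<alpha> n makes the floor exact.\<close>
      then have l: "real l = \<alpha> * real n"
        using n(3) by (simp add: l_def)
      also have "\<dots> \<le> 1/2 * real n" using assms by (intro mult_right_mono) auto
      finally have lm: "l \<le> m" by (simp add: m)
      let ?S = "\<Sum>x\<le>m. of_nat x * pdist x (2*m) m (2*l) l"
      have "?F n = ?S / of_nat n"
        unfolding l_def[symmetric] sum_divide_distrib by (intro sum.cong) (auto simp: m)
      moreover have "\<alpha> = real l / real n" unfolding l using npos by simp
      then have "complex_of_real \<alpha> = of_nat l / of_nat n" by simp
      ultimately have "dist (?F n) (complex_of_real \<alpha>) = cmod (?S - of_nat l) / real n"
        by (simp add: dist_norm norm_divide flip: diff_divide_distrib)
      also have "\<dots> \<le> (e * real n / 2 + 10 * real m ^ 3 / (e * real n / 2) ^ 3) / real n"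
        using mean_deviation_le[OF lm, of "e * real n / 2"] e npos by (intro divide_right_mono) auto
      also have "\<dots> = e / 2 + 10 / (e ^ 3 * real n)"
        using e npos by (simp add: m field_simps power3_eq_cube)
      also have "\<dots> < e"
      proof -
        have "20 < e ^ 4 * real n" using n(1) e by (simp add: field_simps)
        also have "\<dots> = e * (e ^ 3 * real n)" by (simp add: power_Suc[symmetric] del: power_Suc)
        finally have "10 / (e ^ 3 * real n) < e / 2" using e npos by (simp add: field_simps)
        then show ?thesis by simp
      qed
      finally show ?thesis .
    qed
    obtain N :: nat where "20 / e ^ 4 < real N" using reals_Archimedean2 by blast
    then have "eventually (\<lambda>n. 20 / e ^ 4 < real n) at_top"
      unfolding eventually_at_top_linorder by (intro exI[of _ N]) (meson less_le_trans of_nat_le_iff)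
    then show "eventually (\<lambda>n. dist (?F n) (complex_of_real \<alpha>) < e)
        (inf at_top (principal {n. even n \<and> \<alpha> * real n \<in> \<int>}))"
      unfolding eventually_inf_principal by eventually_elim (blast intro: bound)
  qed
qed

end
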